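(* Let $(n,p,k)$ be an admissible triple with $(n,p,k)=(3,2,2),(5,4,2),(5,4,4)$ or $n\ge7$. Put $\lambda^2=\frac{k(k+n-1)}{p}$ and $\varphi_0=\sqrt{\frac{p-n\lambda^{-2}}{n-p}}$. Then there exists a smooth solution $t\in\mathbb R\mapsto(\varphi(t),\psi(t))$ of the system $$\begin{cases}\varphi_t=\psi,\\ \psi_t=-\psi-\Big[\big(n-p+\frac{p}{1+\lambda^2\varphi^2}\big)\psi+\big(n-p+\frac{(1-\lambda^2)p}{1+\lambda^2\varphi^2}\big)\varphi\Big]\big[1+(\varphi+\psi)^2\big],\end{cases}$$ with the following properties: - $\lim_{t\to-\infty}(\varphi(t),\psi(t))=(0,0)$; - $\varphi(t)=O(e^{(k-1)t})$ and $\psi(t)=O(e^{(k-1)t})$ as $t\to-\infty$; - $\lim_{t\to+\infty}(\varphi(t),\psi(t))=(\varphi_0,0)$; - $t\mapsto\varphi(t)$ is strictly increasing; - $\psi(t)>0$ for every $t\in\mathbb R$.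
   Context: A triple $(n,p,k)$ is called admissible here if it is the type of an LOMSE (a certain class of maps $S^n\to S^m$ of constant rank $p$ given by spherical harmonics of degree $k$); by the paper's classification this means exactly: $k$ is a positive even integer and $(n,p)=(15,8)$, or $(n,p)=(2l+1,2l)$, or $(n,p)=(4l+3,4l)$ for some positive integer $l$. *)

theory Defs
  imports "HOL-Analysis.Analysis" "HOL-Library.Landau_Symbols"
begin

text \<open>
  Types $(n,p,k)$ of LOMSEs (maps $S^n \to S^m$ of constant rank $p$ given by spherical harmonics
  of degree $k$), in the explicit form provided by their classification.
\<close>

definition admissible :: "nat \<Rightarrow> nat \<Rightarrow> nat \<Rightarrow> bool" where
  "admissible n p k \<longleftrightarrow>
     k > 0 \<and> even k \<and>
     ((n, p) = (15, 8) \<or>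
      (\<exists>l>0. (n, p) = (2 * l + 1, 2 * l)) \<or>
      (\<exists>l>0. (n, p) = (4 * l + 3, 4 * l)))"

definition smooth :: "(real \<Rightarrow> real) \<Rightarrow> bool" where
  "smooth f \<longleftrightarrow> (\<forall>m. (deriv ^^ m) f differentiable_on UNIV)"

end

theory Submission
  imports Defs
begin

text \<open>
  Since \<open>\<psi> > 0\<close> along the wanted orbit, \<open>\<psi> / \<phi>\<close> is a function of \<open>\<phi>\<close>, which solves a scalar
  equation of first order. The zero \<open>1 - \<phi>\<^sup>2 / \<phi>\<^sub>0\<^sup>2\<close> of this function at the second rest point is
  divided out, and a logarithmic reparametrisation moves both rest points to infinity. On the whole
  line the equation then has explicit positive, bounded sub- and supersolutions, and monotone
  iteration gives a solution between them. The conditions on \<open>(n, p, k)\<close> enter through the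
  supersolution: they make both eigenvalues at \<open>(\<phi>\<^sub>0, 0)\<close> real. Integrating one more autonomous
  equation recovers the time, and the subsolution, which equals \<open>k - 1\<close> at the origin, gives the
  decay rate at \<open>-\<infinity>\<close>.
\<close>

section \<open>Scalar differential equations on the line\<close>

text \<open>Both rest points are singular for the scalar equation: in the variable \<open>x\<close>
  it reads x (1 - x) dz/dx = \<open>F x z\<close>, so no initial value can be prescribed there and
  local existence theorems do not apply. On the whole line, boundedness takes the place of the
  initial value, and no invariant manifold has to be constructed.

  The slopes in the supersolution come from the linearisation at the second rest point. With M = k
  (k + n - 1), the line \<psi> = s (\<open>\<phi>\<^sub>0\<close> - \<phi>) is invariant to first
  order iff s^2 - (n + 1) s + 2 n (1 - n / M) = 0, and this polynomial must not be positive at the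
  slope of a supersolution. For n >= 7 the value s = 3 serves for every k, since 9 - 3 (n + 1) + 2 n
  = 6 - n < 0. For n = 5 the only even k with real roots are 2 and 4, and 3 lies between the roots
  in both cases. For n = 3 only k = 2 is left; the roots are 3/2 and 5/2, so that 3 is too large and
  2 is used. This explains the list of triples.\<close>

lemma real_antiderivative:
  fixes f :: "real \<Rightarrow> real"
  assumes "continuous_on UNIV f"
  obtains P where "\<And>t. (P has_real_derivative f t) (at t)"
proof -
  have "\<exists>F. \<forall>x :: real. - \<infinity> < ereal x \<longrightarrow> ereal x < \<infinity> \<longrightarrow> (F has_vector_derivative f x) (at x)"
    by (rule einterval_antiderivative)
      (use assms in \<open>auto simp: continuous_on_eq_continuous_at\<close>)
  then show ?thesis
    using that by (auto simp: has_real_derivative_iff_has_vector_derivative)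
qed

text \<open>The solution is the integral of exp (- C (t - s)) g(s) over s <= t. The improper
  integral is avoided: \<open>l\<close> plays the limit of \<open>P\<close> at minus infinity. It is
  found as an infimum, because \<open>P + e\<close> is nondecreasing, \<open>P - e\<close> is
  nonincreasing and \<open>e\<close> tends to 0 there.\<close>

lemma bounded_solution_linear:
  fixes g :: "real \<Rightarrow> real"
  assumes C: "C > 0" and g: "continuous_on UNIV g" and K: "\<And>t. \<bar>g t\<bar> \<le> K"
  obtains v where "\<And>t. (v has_real_derivative g t - C * v t) (at t)" "\<And>t. \<bar>v t\<bar> \<le> K / C"
proof -
  obtain P where P: "\<And>t. (P has_real_derivative exp (C * t) * g t) (at t)"
    by (rule real_antiderivative[of "\<lambda>t. exp (C * t) * g t"])
      (auto intro!: continuous_intros g)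
  define e where "e t = K / C * exp (C * t)" for t
  have e: "(e has_real_derivative K * exp (C * t)) (at t)" for t
    unfolding e_def using C by (auto intro!: derivative_eq_intros)
  have K_le: "g t \<le> K" "- K \<le> g t" for t
    using K[of t] by linarith+
  have up: "P s + e s \<le> P t + e t" if "s \<le> t" for s t
  proof (rule DERIV_nonneg_imp_nondecreasing[OF that])
    fix x
    have "0 \<le> exp (C * x) * (g x + K)"
      using K_le[of x] by (intro mult_nonneg_nonneg) auto
    moreover have "((\<lambda>t. P t + e t) has_real_derivative exp (C * x) * (g x + K)) (at x)"
      by (rule DERIV_cong[OF DERIV_add[OF P e]]) (simp add: algebra_simps)
    ultimately show "\<exists>y. ((\<lambda>t. P t + e t) has_real_derivative y) (at x) \<and> 0 \<le> y"
      by blast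
  qed
  have down: "P t - e t \<le> P s - e s" if "s \<le> t" for s t
  proof (rule DERIV_nonpos_imp_nonincreasing[OF that])
    fix x
    have "exp (C * x) * (g x - K) \<le> 0"
      using K_le[of x] by (intro mult_nonneg_nonpos) auto
    moreover have "((\<lambda>t. P t - e t) has_real_derivative exp (C * x) * (g x - K)) (at x)"
      by (rule DERIV_cong[OF DERIV_diff[OF P e]]) (simp add: algebra_simps)
    ultimately show "\<exists>y. ((\<lambda>t. P t - e t) has_real_derivative y) (at x) \<and> y \<le> 0"
      by blast
  qed
  have "K \<ge> 0"
    using K[of 0] by linarith
  then have e_nonneg: "e t \<ge> 0" for t
    using C by (simp add: e_def)
  have cross: "P t - e t \<le> P s + e s" for s t
    using up[of t s] down[of s t] e_nonneg[of s] e_nonneg[of t] by (cases "s \<le> t") auto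
  define l where "l = (INF s. P s + e s)"
  have l_le: "l \<le> P t + e t" for t
    unfolding l_def by (intro cINF_lower bdd_belowI2[of _ "P 0 - e 0"] cross) auto
  have le_l: "P t - e t \<le> l" for t
    unfolding l_def by (intro cINF_greatest cross) auto
  define v where "v t = exp (- C * t) * (P t - l)" for t
  have "(v has_real_derivative g t - C * v t) (at t)" for t
    unfolding v_def
    by (auto intro!: derivative_eq_intros P simp: algebra_simps simp flip: exp_add)
  moreover have "\<bar>v t\<bar> \<le> K / C" for t
  proof -
    have "\<bar>P t - l\<bar> \<le> e t"
      using l_le[of t] le_l[of t] by linarith
    then have "\<bar>v t\<bar> \<le> exp (- C * t) * e t"
      by (simp add: v_def abs_mult)
    also have "\<dots> = K / C"
      by (simp add: e_def flip: exp_add)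
    finally show ?thesis .
  qed
  ultimately show ?thesis
    by (rule that)
qed

text \<open>The product \<open>exp (C * t) * D t\<close> is nondecreasing and, as \<open>D\<close>
  is bounded, tends to 0 at minus infinity. Applied to differences, this is a comparison principle
  in which boundedness replaces an initial condition.\<close>

lemma bounded_differential_ineq_nonneg:
  fixes D :: "real \<Rightarrow> real"
  assumes C: "C > 0" and D: "\<And>t. (D has_real_derivative D' t) (at t)"
    and B: "\<And>t. \<bar>D t\<bar> \<le> B" and ineq: "\<And>t. 0 \<le> D' t + C * D t"
  shows "0 \<le> D t"
proof -
  have mono: "exp (C * s) * D s \<le> exp (C * t) * D t" if "s \<le> t" for s
  proof (rule DERIV_nonneg_imp_nondecreasing[OF that])
    fix x
    have "((\<lambda>t. exp (C * t) * D t) has_real_derivative exp (C * x) * (D' x + C * D x)) (at x)"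
      by (auto intro!: derivative_eq_intros D simp: algebra_simps)
    then show "\<exists>y. ((\<lambda>t. exp (C * t) * D t) has_real_derivative y) (at x) \<and> 0 \<le> y"
      using ineq[of x] by auto
  qed
  have "((\<lambda>s. - (exp (C * s) * B)) \<longlongrightarrow> - (0 * B)) at_bot"
    by (intro tendsto_intros filterlim_compose[OF exp_at_bot]
        filterlim_tendsto_pos_mult_at_bot[OF tendsto_const C filterlim_ident])
  moreover have "\<forall>\<^sub>F s in at_bot. - (exp (C * s) * B) \<le> exp (C * t) * D t"
  proof (rule eventually_mono[OF eventually_le_at_bot[of t]])
    fix s :: real
    assume "s \<le> t"
    have "exp (C * s) * (- B) \<le> exp (C * s) * D s"
      using B[of s] by (intro mult_left_mono) auto
    with mono[OF \<open>s \<le> t\<close>] show "- (exp (C * s) * B) \<le> exp (C * t) * D t"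
      by simp
  qed
  ultimately have "- (0 * B) \<le> exp (C * t) * D t"
    by (intro tendsto_upperbound) auto
  then show ?thesis
    by (simp add: zero_le_mult_iff)
qed

text \<open>The iterates solve \<open>w' + C w = F t u + C u\<close>; the term \<open>C u\<close> makes the right-hand side
  increasing in \<open>u\<close>, so that they decrease from \<open>\<beta>\<close> and stay above \<open>\<alpha>\<close>.\<close>

lemma solution_between_barriers:
  fixes F :: "real \<Rightarrow> real \<Rightarrow> real" and \<alpha> \<beta> :: "real \<Rightarrow> real"
  assumes C: "C > 0"
    and le: "\<And>t. \<alpha> t \<le> \<beta> t"
    and bdd: "\<And>t. \<bar>\<alpha> t\<bar> \<le> B" "\<And>t. \<bar>\<beta> t\<bar> \<le> B"
    and contF: "continuous_on {(t, u). \<alpha> t \<le> u \<and> u \<le> \<beta> t} (\<lambda>(t, u). F t u)"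
    and bddF: "\<And>t u. \<alpha> t \<le> u \<Longrightarrow> u \<le> \<beta> t \<Longrightarrow> \<bar>F t u + C * u\<bar> \<le> K"
    and monoF: "\<And>t u v. \<alpha> t \<le> u \<Longrightarrow> u \<le> v \<Longrightarrow> v \<le> \<beta> t \<Longrightarrow> F t u + C * u \<le> F t v + C * v"
    and \<alpha>: "\<And>t. (\<alpha> has_real_derivative \<alpha>' t) (at t)" "\<And>t. \<alpha>' t \<le> F t (\<alpha> t)"
    and \<beta>: "\<And>t. (\<beta> has_real_derivative \<beta>' t) (at t)" "\<And>t. F t (\<beta> t) \<le> \<beta>' t"
  obtains w where "\<And>t. \<alpha> t \<le> w t" "\<And>t. w t \<le> \<beta> t"
    "\<And>t. (w has_real_derivative F t (w t)) (at t)"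
proof -
  define good where
    "good u \<longleftrightarrow> continuous_on UNIV u \<and> (\<forall>t. \<alpha> t \<le> u t \<and> u t \<le> \<beta> t)" for u :: "real \<Rightarrow> real"
  define step where
    "step u v \<longleftrightarrow> (\<forall>t. (v has_real_derivative F t (u t) + C * u t - C * v t) (at t))"
    for u v :: "real \<Rightarrow> real"
  have K: "K \<ge> 0"
    using bddF[OF order.refl le[of 0]] by linarith
  have good_cont: "continuous_on UNIV (\<lambda>t. F t (u t))" if "good u" for u
    using that unfolding good_def
    by (intro continuous_on_compose2[OF contF, of UNIV "\<lambda>t. (t, u t)", simplified])
      (auto intro!: continuous_intros)
  have good_bdd: "\<bar>u t\<bar> \<le> B" if "good u" for u t
    using that bdd(1)[of t] bdd(2)[of t] unfolding good_def by (smt (verit))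
  have mono_step: "v t \<le> v' t"
    if "good v" "good v'" "step u v" "step u' v'" "good u" "good u'" "\<And>t. u t \<le> u' t" for u u' v v' t
  proof -
    have "0 \<le> v' t - v t"
    proof (rule bounded_differential_ineq_nonneg[where D = "\<lambda>t. v' t - v t" and t = t, OF C])
      show "((\<lambda>t. v' t - v t) has_real_derivative
          (F t (u' t) + C * u' t - C * v' t) - (F t (u t) + C * u t - C * v t)) (at t)" for t
        using that by (intro DERIV_diff) (auto simp: step_def)
      show "\<bar>v' t - v t\<bar> \<le> 2 * B" for t
        using good_bdd[OF that(1), of t] good_bdd[OF that(2), of t] by linarith
      show "0 \<le> (F t (u' t) + C * u' t - C * v' t) - (F t (u t) + C * u t - C * v t)
          + C * (v' t - v t)" for t
        using monoF[of t "u t" "u' t"] that by (auto simp: good_def algebra_simps)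
    qed
    then show ?thesis
      by simp
  qed
  have ex_step: "\<exists>v. good v \<and> step u v" if u: "good u" for u
  proof -
    have cont: "continuous_on UNIV (\<lambda>t. F t (u t) + C * u t)"
      using good_cont[OF u] u by (auto simp: good_def intro!: continuous_intros)
    have bound: "\<bar>F t (u t) + C * u t\<bar> \<le> K" for t
      using u by (intro bddF) (auto simp: good_def)
    obtain v where v: "\<And>t. (v has_real_derivative (F t (u t) + C * u t) - C * v t) (at t)"
      and vb: "\<And>t. \<bar>v t\<bar> \<le> K / C"
      using bounded_solution_linear[OF C cont bound] by blast
    have "0 \<le> v t - \<alpha> t" for t
    proof (rule bounded_differential_ineq_nonneg[where D = "\<lambda>t. v t - \<alpha> t" and t = t, OF C])
      show "((\<lambda>t. v t - \<alpha> t) has_real_derivative (F t (u t) + C * u t - C * v t) - \<alpha>' t) (at t)" for t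
        by (intro DERIV_diff v \<alpha>)
      show "\<bar>v t - \<alpha> t\<bar> \<le> K / C + B" for t
        using vb[of t] bdd(1)[of t] by linarith
      show "0 \<le> (F t (u t) + C * u t - C * v t) - \<alpha>' t + C * (v t - \<alpha> t)" for t
        using monoF[of t "\<alpha> t" "u t"] \<alpha>(2)[of t] u by (auto simp: good_def algebra_simps)
    qed
    moreover have "0 \<le> \<beta> t - v t" for t
    proof (rule bounded_differential_ineq_nonneg[where D = "\<lambda>t. \<beta> t - v t" and t = t, OF C])
      show "((\<lambda>t. \<beta> t - v t) has_real_derivative \<beta>' t - (F t (u t) + C * u t - C * v t)) (at t)" for t
        by (intro DERIV_diff v \<beta>)
      show "\<bar>\<beta> t - v t\<bar> \<le> K / C + B" for t
        using vb[of t] bdd(2)[of t] by linarith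
      show "0 \<le> \<beta>' t - (F t (u t) + C * u t - C * v t) + C * (\<beta> t - v t)" for t
        using monoF[of t "u t" "\<beta> t"] \<beta>(2)[of t] u by (auto simp: good_def algebra_simps)
    qed
    moreover have "continuous_on UNIV v"
      using v by (meson DERIV_isCont continuous_at_imp_continuous_on)
    ultimately show ?thesis
      using v by (auto simp: good_def step_def)
  qed
  have good_\<beta>: "good \<beta>"
    using \<beta>(1) le by (auto simp: good_def intro!: continuous_at_imp_continuous_on DERIV_isCont)
  obtain S where S: "\<And>u. good u \<Longrightarrow> good (S u) \<and> step u (S u)"
    using ex_step by metis
  define w where "w j = (S ^^ j) \<beta>" for j
  have good_w: "good (w j)" for j
    by (induction j) (use S good_\<beta> in \<open>auto simp: w_def\<close>)
  have w: "\<And>j. good (w j)" "w 0 = \<beta>" "\<And>j. step (w j) (w (Suc j))"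
    using good_w S[OF good_w] by (auto simp: w_def)
  have dec: "w (Suc j) t \<le> w j t" for j t
  proof (induction j arbitrary: t)
    case 0
    show ?case
      using w(1)[of 1] by (simp add: w(2) good_def)
  next
    case (Suc j)
    show ?case
      by (rule mono_step[of "w (Suc (Suc j))" "w (Suc j)" "w (Suc j)" "w j"]) (use w Suc in auto)
  qed
  define v where "v t = (INF j. w j t)" for t
  have lim: "(\<lambda>j. w j t) \<longlonglongrightarrow> v t" for t
    unfolding v_def using w(1) dec
    by (intro LIMSEQ_decseq_INF bdd_belowI2[of _ "\<alpha> t"] decseq_SucI) (auto simp: good_def)
  have v_between: "\<alpha> t \<le> v t" "v t \<le> \<beta> t" for t
    using w(1) by (auto intro!: LIMSEQ_le_const[OF lim] LIMSEQ_le_const2[OF lim] simp: good_def)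
  \<comment> \<open>A bound for the derivatives of all iterates at once: it makes the pointwise
    limit \<open>v\<close> Lipschitz, hence \<open>F t (v t)\<close> continuous with an
    antiderivative \<open>H\<close>, and it is also the dominating function when the limit is taken
    under the integral.\<close>
  define L where "L = K + C * B"
  have deriv_bdd: "\<bar>F t (w j t) + C * w j t - C * w (Suc j) t\<bar> \<le> L" for j t
  proof -
    have "\<bar>C * w (Suc j) t\<bar> \<le> C * B"
      using good_bdd[OF w(1)] C by (simp add: abs_mult)
    moreover have "\<bar>F t (w j t) + C * w j t\<bar> \<le> K"
      using w(1) by (intro bddF) (auto simp: good_def)
    ultimately show ?thesis
      unfolding L_def by linarith
  qed
  have lip_w: "\<bar>w (Suc j) s - w (Suc j) t\<bar> \<le> L * \<bar>s - t\<bar>" for j s t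
    using field_differentiable_bound[of UNIV "w (Suc j)"
        "\<lambda>t. F t (w j t) + C * w j t - C * w (Suc j) t" L s t] w(3)[of j] deriv_bdd
    by (auto simp: step_def intro: has_field_derivative_at_within)
  have "\<bar>v s - v t\<bar> \<le> L * \<bar>s - t\<bar>" for s t
    by (rule tendsto_upperbound[where F = sequentially and f = "\<lambda>j. \<bar>w (Suc j) s - w (Suc j) t\<bar>"])
      (intro tendsto_intros LIMSEQ_Suc lim, use lip_w in auto)
  then have "L-lipschitz_on UNIV v"
    using K C bdd(1)[of 0] by (intro lipschitz_onI) (auto simp: dist_real_def L_def)
  then have "continuous_on UNIV v"
    by (rule lipschitz_on_continuous_on)
  with v_between have good_v: "good v"
    by (simp add: good_def)
  obtain H where H: "\<And>t. (H has_real_derivative F t (v t)) (at t)"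
    using real_antiderivative[OF good_cont[OF good_v]] by blast
  have "v b - v a = H b - H a" if "a \<le> b" for a b
  proof -
    have limF: "(\<lambda>j. F t (w j t)) \<longlonglongrightarrow> F t (v t)" for t
    proof -
      have "(\<lambda>j. (\<lambda>(t, u). F t u) (t, w j t)) \<longlonglongrightarrow> (\<lambda>(t, u). F t u) (t, v t)"
        using w(1) v_between
        by (intro continuous_on_tendsto_compose[OF contF] tendsto_intros lim)
          (auto simp: good_def)
      then show ?thesis
        by simp
    qed
    have "((\<lambda>t. F t (v t) + C * v t - C * v t) has_integral v b - v a) {a..b}"
    proof (rule has_integral_dominated_convergence)
      show "((\<lambda>t. F t (w j t) + C * w j t - C * w (Suc j) t) has_integral w (Suc j) b - w (Suc j) a) {a..b}" for j
        using w(3)[of j] that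
        by (intro fundamental_theorem_of_calculus)
          (auto simp: step_def simp flip: has_real_derivative_iff_has_vector_derivative
            intro: has_field_derivative_at_within)
      show "(\<lambda>_. L) integrable_on {a..b}"
        by (rule integrable_const_ivl)
      show "\<forall>t\<in>{a..b}. norm (F t (w j t) + C * w j t - C * w (Suc j) t) \<le> L" for j
        using deriv_bdd by simp
      show "\<forall>t\<in>{a..b}. (\<lambda>j. F t (w j t) + C * w j t - C * w (Suc j) t) \<longlonglongrightarrow> F t (v t) + C * v t - C * v t"
        by (intro ballI tendsto_intros limF lim LIMSEQ_Suc)
      show "(\<lambda>j. w (Suc j) b - w (Suc j) a) \<longlonglongrightarrow> v b - v a"
        by (intro tendsto_intros lim LIMSEQ_Suc)
    qed
    moreover have "((\<lambda>t. F t (v t)) has_integral H b - H a) {a..b}"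
      using H that by (intro fundamental_theorem_of_calculus)
        (auto simp flip: has_real_derivative_iff_has_vector_derivative
            intro: has_field_derivative_at_within)
    ultimately show ?thesis
      by (auto dest: has_integral_unique)
  qed
  then have "v t = H t + (v 0 - H 0)" for t
    by (smt (verit))
  then have v_eq: "v = (\<lambda>t. H t + (v 0 - H 0))"
    by (rule ext)
  have "(v has_real_derivative F t (v t)) (at t)" for t
    by (subst v_eq) (auto intro!: derivative_eq_intros H)
  with v_between show ?thesis
    by (rule that)
qed

text \<open>Separation of variables: \<open>\<theta>\<close> is the inverse of the time function
  \<open>T\<close>, an antiderivative of \<open>1 / f\<close>. The upper bound on \<open>f\<close>
  makes \<open>T\<close> grow at least linearly, hence onto; the lower bound makes
  \<open>\<theta>\<close> grow at least linearly, hence tend to both infinities. Continuity of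
  \<open>f\<close> suffices.\<close>

lemma autonomous_ode_solution:
  fixes f :: "real \<Rightarrow> real"
  assumes f: "continuous_on UNIV f" and m: "m > 0" and fm: "\<And>x. m \<le> f x"
    and fM: "\<And>x. f x \<le> M"
  obtains \<theta> where "\<And>t. (\<theta> has_real_derivative f (\<theta> t)) (at t)"
    "filterlim \<theta> at_top at_top" "filterlim \<theta> at_bot at_bot"
proof -
  have f_pos: "f x > 0" for x
    using m fm[of x] by linarith
  have M: "M > 0"
    using f_pos[of 0] fM[of 0] by linarith
  obtain P where P: "\<And>x. (P has_real_derivative 1 / f x) (at x)"
    by (rule real_antiderivative[of "\<lambda>x. 1 / f x"])
      (use f f_pos in \<open>auto intro!: continuous_intros simp: less_imp_neq[symmetric]\<close>)
  define T where "T x = P x - P 0" for x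
  have T: "(T has_real_derivative 1 / f x) (at x)" for x
    unfolding T_def using P by (auto intro!: derivative_eq_intros)
  have T_growth: "(y - x) / M \<le> T y - T x" if "x \<le> y" for x y
  proof -
    have "T x - x / M \<le> T y - y / M"
    proof (rule DERIV_nonneg_imp_nondecreasing[OF that])
      fix u
      have "((\<lambda>x. T x - x / M) has_real_derivative 1 / f u - 1 / M) (at u)"
        using M by (auto intro!: derivative_eq_intros T)
      moreover have "1 / M \<le> 1 / f u"
        using fM[of u] f_pos[of u] by (intro divide_left_mono) (use M in auto)
      ultimately show "\<exists>y. ((\<lambda>x. T x - x / M) has_real_derivative y) (at u) \<and> 0 \<le> y"
        by (intro exI[of _ "1 / f u - 1 / M"]) auto
    qed
    then show ?thesis
      by (simp add: diff_divide_distrib)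
  qed
  have T_strict: "T x < T y" if "x < y" for x y
  proof -
    have "0 < (y - x) / M"
      using that M by simp
    with T_growth[of x y] that show ?thesis
      by linarith
  qed
  have contT: "continuous_on S T" for S
    using T by (meson DERIV_isCont continuous_at_imp_continuous_on)
  have "\<exists>x. T x = t" for t
  proof -
    have T0: "T 0 = 0"
      by (simp add: T_def)
    have "T (- M * \<bar>t\<bar>) \<le> t" "t \<le> T (M * \<bar>t\<bar>)"
      using T_growth[of "- M * \<bar>t\<bar>" 0] T_growth[of 0 "M * \<bar>t\<bar>"] M T0 by (auto simp: abs_if split: if_splits)
    moreover have "- M * \<bar>t\<bar> \<le> M * \<bar>t\<bar>"
      using M by auto
    ultimately show ?thesis
      using IVT'[of T "- M * \<bar>t\<bar>" t "M * \<bar>t\<bar>"] contT by blast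
  qed
  then obtain \<theta> where T\<theta>: "\<And>t. T (\<theta> t) = t"
    by metis
  have \<theta>T: "\<theta> (T x) = x" for x
    using T\<theta>[of "T x"] T_strict by (metis linorder_neqE less_irrefl)
  have \<theta>: "(\<theta> has_real_derivative f (\<theta> t)) (at t)" for t
  proof -
    have "(\<theta> has_derivative (\<lambda>h. f (\<theta> t) * h)) (at t)"
    proof (rule has_derivative_inverse_strong_x[where f = T and S = UNIV and f' = "\<lambda>h. 1 / f (\<theta> t) * h"])
      show "(T has_derivative (\<lambda>h. 1 / f (\<theta> t) * h)) (at (\<theta> t))"
        using T[of "\<theta> t"] by (simp only: has_field_derivative_def)
      show "(\<lambda>h. 1 / f (\<theta> t) * h) \<circ> (\<lambda>h. f (\<theta> t) * h) = id"
        using f_pos[of "\<theta> t"] by (auto simp: fun_eq_iff)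
    qed (use contT T\<theta> \<theta>T in auto)
    then show ?thesis
      by (simp add: has_field_derivative_def)
  qed
  have growth: "\<theta> s + m * (t - s) \<le> \<theta> t" if "s \<le> t" for s t
  proof -
    have "\<theta> s - m * s \<le> \<theta> t - m * t"
    proof (rule DERIV_nonneg_imp_nondecreasing[OF that])
      fix u
      have "((\<lambda>t. \<theta> t - m * t) has_real_derivative f (\<theta> u) - m) (at u)"
        by (auto intro!: derivative_eq_intros \<theta>)
      then show "\<exists>y. ((\<lambda>t. \<theta> t - m * t) has_real_derivative y) (at u) \<and> 0 \<le> y"
        using fm[of "\<theta> u"] by (intro exI[of _ "f (\<theta> u) - m"]) auto
    qed
    then show ?thesis
      by (simp add: algebra_simps)
  qed
  have \<theta>0: "\<theta> 0 = 0"
    using \<theta>T[of 0] by (simp add: T_def)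
  have "filterlim \<theta> at_top at_top"
  proof (rule filterlim_at_top_mono)
    show "filterlim (\<lambda>t. m * t) at_top at_top"
      using m by (intro filterlim_tendsto_pos_mult_at_top[OF tendsto_const] filterlim_ident)
    show "\<forall>\<^sub>F t in at_top. m * t \<le> \<theta> t"
      using eventually_ge_at_top[of 0] by eventually_elim (use growth[of 0] \<theta>0 in auto)
  qed
  moreover have "filterlim \<theta> at_bot at_bot"
  proof (rule filterlim_at_bot_mono)
    show "filterlim (\<lambda>t. m * t) at_bot at_bot"
      using m by (intro filterlim_tendsto_pos_mult_at_bot[OF tendsto_const] filterlim_ident)
    show "\<forall>\<^sub>F t in at_bot. \<theta> t \<le> m * t"
      using eventually_le_at_bot[of 0] by eventually_elim (use growth[of _ 0] \<theta>0 in auto)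
  qed
  ultimately show ?thesis
    using \<theta> by (intro that)
qed

section \<open>Smoothness from differential algebra\<close>

text \<open>Polynomial expressions in the functions of \<open>S\<close>. There is no closure under
  reciprocals, so a denominator has to enter through a generator of its own.\<close>

inductive_set generated_algebra :: "(real \<Rightarrow> real) set \<Rightarrow> (real \<Rightarrow> real) set" for S where
  base: "f \<in> S \<Longrightarrow> f \<in> generated_algebra S"
| const: "(\<lambda>_. c) \<in> generated_algebra S"
| add: "f \<in> generated_algebra S \<Longrightarrow> g \<in> generated_algebra S \<Longrightarrow>
    (\<lambda>t. f t + g t) \<in> generated_algebra S"
| mult: "f \<in> generated_algebra S \<Longrightarrow> g \<in> generated_algebra S \<Longrightarrow>
    (\<lambda>t. f t * g t) \<in> generated_algebra S"

lemma generated_algebra_diff: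
  assumes "f \<in> generated_algebra S" "g \<in> generated_algebra S"
  shows "(\<lambda>t. f t - g t) \<in> generated_algebra S"
  using generated_algebra.add[OF assms(1) generated_algebra.mult[OF generated_algebra.const[of "-1"] assms(2)]]
  by simp

text \<open>By the sum and product rules the derivative maps the whole algebra into itself as soon
  as it maps the generators into it. All iterated derivatives then stay inside, and no formula for
  them is needed.\<close>

lemma generated_algebra_smooth:
  assumes S: "\<And>s. s \<in> S \<Longrightarrow> \<exists>s'\<in>generated_algebra S. \<forall>t. (s has_real_derivative s' t) (at t)"
    and f: "f \<in> generated_algebra S"
  shows "smooth f"
proof -
  have deriv_ex: "\<exists>g'\<in>generated_algebra S. \<forall>t. (g has_real_derivative g' t) (at t)"
    if "g \<in> generated_algebra S" for g
    using that
  proof induction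
    case (base f)
    then show ?case
      by (rule S)
  next
    case (const c)
    show ?case
      by (rule bexI[OF _ generated_algebra.const[of 0]]) simp
  next
    case (add f g)
    then obtain f' g' where f': "f' \<in> generated_algebra S" "\<And>t. (f has_real_derivative f' t) (at t)"
      and g': "g' \<in> generated_algebra S" "\<And>t. (g has_real_derivative g' t) (at t)"
      by blast
    show ?case
      by (rule bexI[OF _ generated_algebra.add[OF f'(1) g'(1)]])
        (use f' g' in \<open>auto intro!: derivative_eq_intros\<close>)
  next
    case (mult f g)
    then obtain f' g' where f': "f' \<in> generated_algebra S" "\<And>t. (f has_real_derivative f' t) (at t)"
      and g': "g' \<in> generated_algebra S" "\<And>t. (g has_real_derivative g' t) (at t)"
      by blast
    show ?case
      by (rule bexI[OF _ generated_algebra.add[OF generated_algebra.mult[OF f'(1) mult.hyps(2)]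
              generated_algebra.mult[OF mult.hyps(1) g'(1)]]])
        (use f' g' in \<open>auto intro!: derivative_eq_intros\<close>)
  qed
  have "(deriv ^^ m) f \<in> generated_algebra S" for m
  proof (induction m)
    case (Suc m)
    then obtain g' where g': "g' \<in> generated_algebra S"
      "\<And>t. ((deriv ^^ m) f has_real_derivative g' t) (at t)"
      using deriv_ex by blast
    then have "deriv ((deriv ^^ m) f) = g'"
      by (intro ext DERIV_imp_deriv)
    with g' show ?case
      by simp
  qed (simp add: f)
  then show ?thesis
    unfolding smooth_def differentiable_on_def
    using deriv_ex by (metis real_differentiable_def)
qed

section \<open>The reduced equation and its barriers\<close>

text \<open>The inverse of ln (x / (1 - x)): with this time, x (1 - x) d/dx becomes d/dt, which
  removes the zeros of the leading coefficient at both rest points.\<close>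

definition logistic :: "real \<Rightarrow> real" where
  "logistic t = 1 / (1 + exp (- t))"

lemma logistic_bounds: "0 < logistic t" "logistic t < 1"
  by (auto simp: logistic_def field_simps add_pos_pos)

lemma logistic_has_derivative:
  "(logistic has_real_derivative logistic t * (1 - logistic t)) (at t)"
proof -
  have "1 + exp (- t) > 0"
    by (simp add: add_pos_pos)
  then show ?thesis
    unfolding logistic_def
    by (auto intro!: derivative_eq_intros simp: field_simps power2_eq_square)
qed

lemma logistic_tendsto:
  "(logistic \<longlongrightarrow> 1) at_top" "(logistic \<longlongrightarrow> 0) at_bot"
proof -
  have "((\<lambda>t::real. exp (- t)) \<longlongrightarrow> 0) at_top"
    by (intro filterlim_compose[OF exp_at_bot] filterlim_uminus_at_bot_at_top)
  then have "((\<lambda>t::real. 1 / (1 + exp (- t))) \<longlongrightarrow> 1 / (1 + 0)) at_top"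
    by (intro tendsto_intros) auto
  then show "(logistic \<longlongrightarrow> 1) at_top"
    by (simp add: logistic_def[abs_def])
  have "filterlim (\<lambda>t::real. 1 + exp (- t)) at_top at_bot"
    by (intro filterlim_tendsto_add_at_top[OF tendsto_const]
        filterlim_compose[OF exp_at_top] filterlim_uminus_at_top_at_bot)
  then have "((\<lambda>t::real. 1 / (1 + exp (- t))) \<longlongrightarrow> 0) at_bot"
    by (intro tendsto_divide_0[OF tendsto_const] filterlim_at_top_imp_at_infinity)
  then show "(logistic \<longlongrightarrow> 0) at_bot"
    by (simp add: logistic_def[abs_def])
qed

text \<open>
  In the variables \<open>x = \<phi>\<^sup>2 / \<phi>\<^sub>0\<^sup>2\<close> and \<open>z = \<psi> / (\<phi> (1 - x))\<close>, with \<open>x\<close> as the logistic function of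
  a new time, the system becomes the scalar equation \<open>z' = F x z\<close>, where \<open>M = \<lambda>\<^sup>2 p\<close>. The slope
  \<open>k - 1\<close> of the unstable manifold at the origin is the value of \<open>lower\<close> at \<open>x = 0\<close>. The function
  \<open>upper\<close> has \<open>n + (M - n) x\<close> as denominator because \<open>(M - n) / z - (n + (M - n) x)\<close> is then a
  multiple of it for \<open>z = upper x\<close>; it enters the rest point with \<open>\<psi> = c (\<phi>\<^sub>0 - \<phi>)\<close> to first order, so \<open>- c\<close> has to lie between the
  two eigenvalues there. The assumption \<open>barrier\<close> is the supersolution inequality for \<open>upper\<close>,
  multiplied out.
\<close>

locale profile_equation =
  fixes n p k M c :: real
  assumes p_pos: "0 < p" and p_less: "p + 1 \<le> n" and k: "1 < k"
    and M: "M = k * (k + n - 1)" and c: "2 \<le> c"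
    and barrier: "\<And>x. 0 < x \<Longrightarrow> x < 1 \<Longrightarrow>
      c * x * M / (n + (M - n) * x) \<le>
      (n + (M - n) * x) / M + c / 2 * (1 - x) + (1 - 2 / c * (1 - n / M)) *
        ((n - p) * (n + (M - n) * x)\<^sup>2 / M
          + p * (M - n) * x * ((n + (M - n) * x) / M + c / 2 * (1 - x))\<^sup>2)
        / (n - p + (M - n) * x)"
begin

text \<open>In the original variables, \<open>p * (M - n) * x / (M * (n - p))\<close> is
  \<open>\<phi>\<^sup>2\<close>, \<open>(M - n) * x / (n - p)\<close> is
  \<open>\<lambda>\<^sup>2 * \<phi>\<^sup>2\<close>, and \<open>1 + (1 - x) * z\<close> is 1 +
  \<psi> / \<phi>. The product of the first with the square of the last is therefore the square of
  \<phi> + \<psi>.\<close>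

definition F :: "real \<Rightarrow> real \<Rightarrow> real" where
  "F x z = x * z - (1 + (1 - x) * z) / 2
    + ((M - n) / z - (n + (M - n) * x))
      * (1 + p * (M - n) * x / (M * (n - p)) * (1 + (1 - x) * z)\<^sup>2)
      / (2 * (1 + (M - n) * x / (n - p)))"

text \<open>The coefficient \<open>k\<^sup>2 - 1\<close> makes
  \<open>(M - n) / lower x - (n + (M - n) * x)\<close> collapse to
  \<open>k * (1 + (M - n) * x)\<close>.\<close>

definition lower :: "real \<Rightarrow> real" where
  "lower x = (k - 1) / (1 + (k\<^sup>2 - 1) * x)"

definition upper :: "real \<Rightarrow> real" where
  "upper x = c / 2 * M / (n + (M - n) * x)"

lemma M_minus: "M - n * k = k * (k - 1)"
  by (simp add: M algebra_simps)

lemma M_gt: "n < M" 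
proof -
  have "n * 1 < n * k"
    using k p_pos p_less by (intro mult_strict_left_mono) auto
  moreover have "0 < k * (k - 1)"
    using k by auto
  ultimately show ?thesis
    using M_minus by linarith
qed

lemma pos: "0 < n" "0 < M" "0 < n - p" "0 < M - n" "0 < k\<^sup>2 - 1"
  using p_pos p_less M_gt k by (auto simp: one_less_power)

lemma lower_has_derivative:
  assumes "0 \<le> x"
  shows "(lower has_real_derivative - ((k - 1) * (k\<^sup>2 - 1) / (1 + (k\<^sup>2 - 1) * x)\<^sup>2)) (at x)"
proof -
  have "1 + (k\<^sup>2 - 1) * x > 0"
    using pos assms by (intro add_pos_nonneg) auto
  then show ?thesis
    unfolding lower_def
    by (auto intro!: derivative_eq_intros simp: power2_eq_square)
qed

lemma upper_has_derivative:
  assumes "0 \<le> x"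
  shows "(upper has_real_derivative - (c / 2 * M * (M - n) / (n + (M - n) * x)\<^sup>2)) (at x)"
proof -
  have "n + (M - n) * x > 0"
    using pos assms by (intro add_pos_nonneg) auto
  then show ?thesis
    unfolding upper_def divide_inverse[of "c / 2 * M"] divide_inverse[of "c / 2 * M * (M - n)"]
    by (auto intro!: derivative_eq_intros simp: power2_eq_square mult_ac)
qed

lemma lower_bounds:
  assumes "0 \<le> x" "x \<le> 1"
  shows "(k - 1) / k\<^sup>2 \<le> lower x" "lower x \<le> k - 1"
proof -
  have "(k\<^sup>2 - 1) * x \<le> (k\<^sup>2 - 1) * 1" "0 \<le> (k\<^sup>2 - 1) * x"
    using assms pos by (intro mult_left_mono mult_nonneg_nonneg; auto)+
  then have D: "1 \<le> 1 + (k\<^sup>2 - 1) * x" "1 + (k\<^sup>2 - 1) * x \<le> k\<^sup>2"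
    by auto
  show "(k - 1) / k\<^sup>2 \<le> lower x"
    unfolding lower_def using D k by (intro divide_left_mono) auto
  show "lower x \<le> k - 1"
    using D k divide_left_mono[of 1 "1 + (k\<^sup>2 - 1) * x" "k - 1"] by (auto simp: lower_def)
qed

lemma upper_bounds:
  assumes "0 \<le> x" 
  shows "0 < upper x" "upper x \<le> c / 2 * M / n"
proof -
  have "0 \<le> (M - n) * x"
    using assms pos by simp
  then show "0 < upper x" "upper x \<le> c / 2 * M / n"
    unfolding upper_def using c pos by (auto intro!: divide_left_mono divide_pos_pos mult_pos_pos)
qed

text \<open>After cross-multiplication and replacing c / 2 by 1, both sides are affine in
  \<open>x\<close> and are compared coefficient by coefficient.\<close>

lemma lower_le_upper:
  assumes "0 \<le> x"
  shows "lower x \<le> upper x"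
proof -
  have D: "0 < 1 + (k\<^sup>2 - 1) * x" "0 < n + (M - n) * x"
    using pos assms by (auto intro!: add_pos_nonneg)
  have "(k - 1) * n \<le> M"
  proof -
    have "0 \<le> k * (k - 1)"
      using k by simp
    moreover have "(k - 1) * n = n * k - n"
      by algebra
    ultimately show ?thesis
      using M_minus pos by linarith
  qed
  moreover have "(k - 1) * (M - n) * x \<le> M * (k\<^sup>2 - 1) * x"
  proof -
    have "(k - 1) * (M - n) \<le> (k\<^sup>2 - 1) * M"
      using k pos by (intro mult_mono) (auto simp: power2_eq_square)
    then show ?thesis
      using assms mult_right_mono by (fastforce simp: mult.commute)
  qed
  ultimately have "(k - 1) * (n + (M - n) * x) \<le> 1 * M * (1 + (k\<^sup>2 - 1) * x)"
    by (simp add: algebra_simps)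
  also have "\<dots> \<le> c / 2 * M * (1 + (k\<^sup>2 - 1) * x)"
    using c D pos by (intro mult_right_mono) auto
  finally have "(k - 1) * (n + (M - n) * x) \<le> c / 2 * M * (1 + (k\<^sup>2 - 1) * x)" .
  moreover have "a / b \<le> e / d" if "a * d \<le> e * b" "0 < b" "0 < d" for a b d e :: real
    using that by (simp add: field_simps)
  ultimately show ?thesis
    unfolding lower_def upper_def using D by blast
qed

text \<open>The left-hand side is not positive, so \<open>F x (lower x)\<close> >= 0 is enough. With
  X = (M - n) x the last summand of \<open>F\<close> is at least k / 2, because its factor k (1 + X)
  dominates k (1 + X / (n - p)); this is where n - p >= 1 is used. The subtracted summand is at most
  k / 2, since (1 - x) \<open>lower x\<close> <= k - 1.\<close>

lemma lower_subsolution: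
  assumes x: "0 < x" "x < 1"
  shows "- ((k - 1) * (k\<^sup>2 - 1) / (1 + (k\<^sup>2 - 1) * x)\<^sup>2) * (x * (1 - x)) \<le> F x (lower x)"
proof -
  define A where "A = lower x"
  define X where "X = (M - n) * x"
  have A: "0 < A" "A \<le> k - 1"
    using lower_bounds[of x] x k unfolding A_def by (auto intro: less_le_trans[rotated])
  have X: "0 < X"
    unfolding X_def using pos x by simp
  have D: "0 < 1 + (k\<^sup>2 - 1) * x"
    using pos x by (auto intro!: add_pos_nonneg)
  have "(M - n) / A = (M - n) * (1 + (k\<^sup>2 - 1) * x) / (k - 1)"
    by (simp add: A_def lower_def)
  also have "\<dots> = ((M - n) + X * (k\<^sup>2 - 1)) / (k - 1)"
    by (simp add: X_def algebra_simps)
  also have "\<dots> = k * (1 + X) + (n + X)"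
    using k M_minus by (simp add: divide_simps) (simp add: algebra_simps power2_eq_square)
  finally have eq: "(M - n) / A - (n + X) = k * (1 + X)"
    by simp
  have "k * (1 + X / (n - p)) \<le> k * (1 + X) * 1"
  proof -
    have "X / (n - p) \<le> X / 1"
      using X pos p_less by (intro divide_left_mono) auto
    then show ?thesis
      using k by simp
  qed
  also have "\<dots> \<le> k * (1 + X) * (1 + p * (M - n) * x / (M * (n - p)) * (1 + (1 - x) * A)\<^sup>2)"
    using k X pos x p_pos by (intro mult_left_mono) auto
  finally have le: "k * (1 + X / (n - p)) \<le> \<dots>" .
  have "0 < 1 + X / (n - p)"
    using X pos by (intro add_pos_nonneg) auto
  moreover have "k / 2 \<le> T / (2 * N)" if "k * N \<le> T" "0 < N" for T N
    using that by (simp add: field_simps)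
  ultimately have "k / 2 \<le> k * (1 + X)
      * (1 + p * (M - n) * x / (M * (n - p)) * (1 + (1 - x) * A)\<^sup>2) / (2 * (1 + X / (n - p)))"
    using le by blast
  moreover have "(1 - x) * A \<le> 1 * (k - 1)"
    using x A by (intro mult_mono) auto
  moreover have "0 \<le> x * A"
    using x A by simp
  moreover have "0 \<le> a - (1 + b) / 2 + T" if "k / 2 \<le> T" "b \<le> 1 * (k - 1)" "0 \<le> a" for a b T
    using that by (simp add: field_simps)
  ultimately have "0 \<le> F x A"
    unfolding F_def X_def[symmetric] eq by blast
  moreover have "- ((k - 1) * (k\<^sup>2 - 1) / (1 + (k\<^sup>2 - 1) * x)\<^sup>2) * (x * (1 - x)) \<le> 0"
    using k pos x by (intro mult_nonpos_nonneg) auto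
  ultimately show ?thesis
    unfolding A_def by linarith
qed

text \<open>For z = \<open>upper x\<close> the difference in \<open>F\<close> is - \<kappa> S, which
  turns 2 F into 2 x \<open>upper x\<close> - (U + \<kappa> R) M / S. Inserting
  \<open>barrier\<close> leaves c x M (S - M) / S^2, and S - M = - (M - n) (1 - x) yields exactly
  twice the derivative of \<open>upper\<close> along the logistic time.\<close>

lemma upper_supersolution:
  assumes x: "0 < x" "x < 1"
  shows "F x (upper x) \<le> - (c / 2 * M * (M - n) / (n + (M - n) * x)\<^sup>2) * (x * (1 - x))"
proof -
  define X where "X = (M - n) * x"
  define S where "S = n + X"
  define \<kappa> where "\<kappa> = 1 - 2 / c * (1 - n / M)"
  define U where "U = S / M + c / 2 * (1 - x)"
  define R where "R = ((n - p) * S\<^sup>2 / M + p * X * U\<^sup>2) / (n - p + X)"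
  have X: "0 < X" and S: "0 < S"
    unfolding X_def S_def using pos x by (auto intro!: add_pos_pos)
  have b: "c * x * M / S \<le> U + \<kappa> * R"
    using barrier[OF x] by (simp add: X_def S_def \<kappa>_def U_def R_def mult.assoc)
  have up: "upper x = c / 2 * M / S"
    by (simp add: upper_def S_def X_def)
  have v: "1 + (1 - x) * upper x = U * M / S"
    using S pos by (simp add: up U_def field_simps)
  have eq: "(M - n) / upper x - S = - \<kappa> * S"
    using S pos c by (simp add: up \<kappa>_def divide_simps) (simp add: algebra_simps)
  have coef: "S * ((1 + p * X / (M * (n - p)) * (U * M / S)\<^sup>2) / (1 + X / (n - p))) = R * M / S"
  proof -
    have "n - p + X > 0"
      using X pos by auto
    then show ?thesis
      using S pos X unfolding R_def
      by (simp add: divide_simps power2_eq_square)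
  qed
  have "2 * F x (upper x) = 2 * x * upper x - U * M / S
      - \<kappa> * (S * ((1 + p * X / (M * (n - p)) * (U * M / S)\<^sup>2) / (1 + X / (n - p))))"
    unfolding F_def v mult.assoc[of p "M - n" x] X_def[symmetric] S_def[symmetric] eq
  proof -
    show "2 * (x * u - a / 2 + - \<kappa> * S * Q / (2 * N)) = 2 * x * u - a - \<kappa> * (S * (Q / N))" for u a Q N
      by (simp add: algebra_simps)
  qed
  also have "\<dots> = 2 * x * upper x - (U + \<kappa> * R) * M / S"
    unfolding coef by (simp add: algebra_simps add_divide_distrib)
  also have "\<dots> \<le> 2 * x * upper x - (c * x * M / S) * M / S"
    using mult_right_mono[OF b, of "M / S"] S pos by simp
  also have "\<dots> = - (c * M * (M - n) / S\<^sup>2) * (x * (1 - x))"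
  proof -
    have "(M - S) = (M - n) * (1 - x)"
      by (simp add: S_def X_def algebra_simps)
    then have "2 * x * upper x - (c * x * M / S) * M / S + (c * M * ((M - n) * (1 - x)) / S\<^sup>2) * x = 0"
      using S by (simp flip: \<open>M - S = _\<close> add: up divide_simps power2_eq_square)
        (simp add: algebra_simps)
    then show ?thesis
      by (simp add: algebra_simps)
  qed
  also have "\<dots> = 2 * (- (c / 2 * M * (M - n) / S\<^sup>2) * (x * (1 - x)))"
    by simp
  finally show ?thesis
    unfolding S_def X_def by (rule mult_left_le_imp_le) simp
qed

section \<open>Constants for the monotone iteration, from compactness\<close>

definition region :: "(real \<times> real) set" where
  "region = {0..1} \<times> {(k - 1) / k\<^sup>2..c / 2 * M / n}"

lemma compact_region: "compact region"
  unfolding region_def by (intro compact_Times compact_Icc)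

lemma region_nonzero:
  assumes "y \<in> region"
  shows "snd y \<noteq> 0" "(snd y)\<^sup>2 \<noteq> 0" "2 * (1 + (M - n) * fst y / (n - p)) \<noteq> 0"
proof -
  have "0 < (k - 1) / k\<^sup>2"
    using k by simp
  then show "snd y \<noteq> 0" "(snd y)\<^sup>2 \<noteq> 0"
    using assms unfolding region_def by auto
  have "0 < 1 + (M - n) * fst y / (n - p)"
    using assms pos unfolding region_def by (intro add_pos_nonneg) auto
  then show "2 * (1 + (M - n) * fst y / (n - p)) \<noteq> 0"
    by simp
qed

lemma continuous_on_F: "continuous_on region (\<lambda>y. F (fst y) (snd y))"
proof -
  have nz: "\<forall>y\<in>region. snd y \<noteq> 0" "\<forall>y\<in>region. 2 * (1 + (M - n) * fst y / (n - p)) \<noteq> 0"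
    using region_nonzero by blast+
  have cont: "continuous_on region (\<lambda>y. p * (M - n) * fst y / (M * (n - p)))"
    "continuous_on region (\<lambda>y. 2 * (1 + (M - n) * fst y / (n - p)))"
    unfolding divide_inverse by (rule continuous_intros)+
  show ?thesis
    unfolding F_def
    by (rule continuous_on_add continuous_on_diff continuous_on_mult continuous_on_power
        continuous_on_divide[OF _ _ nz(1)] continuous_on_divide[OF _ _ nz(2)] cont
        continuous_on_divide continuous_on_const continuous_on_fst continuous_on_snd
        continuous_on_id | simp)+
qed

text \<open>\<open>G\<close> is the partial derivative of \<open>F\<close> in \<open>z\<close>. It
  is continuous on the compact rectangle, whose lower edge \<open>lower 1\<close> > 0 keeps away
  from the pole at z = 0, so a bound for its absolute value can serve as \<open>C\<close>.\<close>

lemma F_one_sided_lipschitz: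
  obtains C K where "0 < C"
    "\<And>x u v. (x, u) \<in> region \<Longrightarrow> (x, v) \<in> region \<Longrightarrow> u \<le> v \<Longrightarrow> F x u + C * u \<le> F x v + C * v"
    "\<And>x u. (x, u) \<in> region \<Longrightarrow> \<bar>F x u + C * u\<bar> \<le> K"
proof -
  define G where "G y = (let x = fst y; z = snd y; v = 1 + (1 - x) * z;
      q = p * (M - n) * x / (M * (n - p)) in
    x - (1 - x) / 2 + (- ((M - n) / z\<^sup>2) * (1 + q * v\<^sup>2)
      + ((M - n) / z - (n + (M - n) * x)) * (2 * q * v * (1 - x)))
      / (2 * (1 + (M - n) * x / (n - p))))" for y
  have G: "(F x has_real_derivative G (x, z)) (at z)" if "(x, z) \<in> region" for x z
  proof -
    have *: "z \<noteq> 0" "1 + (M - n) * x / (n - p) \<noteq> 0"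
      using region_nonzero[OF that] by auto
    define Q where "Q = p * (M - n) * x / (M * (n - p))"
    define N where "N = 1 + (M - n) * x / (n - p)"
    show ?thesis
      unfolding F_def[abs_def] G_def Let_def Q_def[symmetric] N_def[symmetric] fst_conv snd_conv
      using * unfolding N_def[symmetric]
      by (auto intro!: derivative_eq_intros simp: power2_eq_square)
        (simp add: field_simps)
  qed
  have nz: "\<forall>y\<in>region. (snd y)\<^sup>2 \<noteq> 0" "\<forall>y\<in>region. snd y \<noteq> 0"
    "\<forall>y\<in>region. 2 * (1 + (M - n) * fst y / (n - p)) \<noteq> 0"
    using region_nonzero by blast+
  have cont: "continuous_on region (\<lambda>y. 1 + (1 - fst y) * snd y)"
    "continuous_on region (\<lambda>y. p * (M - n) * fst y / (M * (n - p)))"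
    "continuous_on region (\<lambda>y. 2 * (1 + (M - n) * fst y / (n - p)))"
    unfolding divide_inverse by (rule continuous_intros)+
  have "continuous_on region G"
    unfolding G_def Let_def
    by (rule continuous_on_add continuous_on_diff continuous_on_minus continuous_on_mult continuous_on_power
        continuous_on_divide[OF _ _ nz(1)] continuous_on_divide[OF _ _ nz(2)]
        continuous_on_divide[OF _ _ nz(3)] cont continuous_on_divide
        continuous_on_const continuous_on_fst continuous_on_snd continuous_on_id | simp)+
  then have "bounded (G ` region)"
    by (intro compact_imp_bounded compact_continuous_image compact_region)
  then obtain C where C: "0 < C" "\<And>y. y \<in> region \<Longrightarrow> \<bar>G y\<bar> \<le> C"
    unfolding bounded_pos ball_simps(9) real_norm_def by blast
  have "continuous_on region (\<lambda>y. F (fst y) (snd y) + C * snd y)"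
    by (intro continuous_intros continuous_on_F)
  then have "bounded ((\<lambda>y. F (fst y) (snd y) + C * snd y) ` region)"
    by (intro compact_imp_bounded compact_continuous_image compact_region)
  then obtain K where K: "\<And>y. y \<in> region \<Longrightarrow> \<bar>F (fst y) (snd y) + C * snd y\<bar> \<le> K"
    unfolding bounded_pos ball_simps(9) real_norm_def by blast
  show ?thesis
  proof (rule that[OF C(1)])
    fix x u v
    assume uv: "(x, u) \<in> region" "(x, v) \<in> region" "u \<le> v"
    show "F x u + C * u \<le> F x v + C * v"
    proof (rule DERIV_nonneg_imp_nondecreasing[OF uv(3)])
      fix z
      assume "u \<le> z" "z \<le> v"
      with uv have "(x, z) \<in> region"
        by (auto simp: region_def)
      then have "((\<lambda>z. F x z + C * z) has_real_derivative G (x, z) + C) (at z)" "0 \<le> G (x, z) + C"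
        using G C(2)[of "(x, z)"] by (auto intro!: derivative_eq_intros)
      then show "\<exists>y. ((\<lambda>z. F x z + C * z) has_real_derivative y) (at z) \<and> 0 \<le> y"
        by blast
    qed
  next
    show "\<bar>F x u + C * u\<bar> \<le> K" if "(x, u) \<in> region" for x u
      using K[OF that] by simp
  qed
qed

lemma reduced_solution:
  obtains z where "\<And>t. lower (logistic t) \<le> z t" "\<And>t. z t \<le> upper (logistic t)"
    "\<And>t. (z has_real_derivative F (logistic t) (z t)) (at t)"
proof -
  obtain C K where C: "0 < C"
    and mono: "\<And>x u v. (x, u) \<in> region \<Longrightarrow> (x, v) \<in> region \<Longrightarrow> u \<le> v \<Longrightarrow> F x u + C * u \<le> F x v + C * v"
    and K: "\<And>x u. (x, u) \<in> region \<Longrightarrow> \<bar>F x u + C * u\<bar> \<le> K"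
    using F_one_sided_lipschitz by blast
  have l: "0 \<le> logistic t" "logistic t \<le> 1" for t
    using logistic_bounds[of t] by auto
  have region: "(logistic t, u) \<in> region" if "lower (logistic t) \<le> u" "u \<le> upper (logistic t)" for t u
    using that lower_bounds[OF l[of t]] upper_bounds[OF l(1)[of t]] l[of t] by (auto simp: region_def)
  have "0 < (k - 1) / k\<^sup>2"
    using k by simp
  then have bdd: "\<bar>lower (logistic t)\<bar> \<le> c / 2 * M / n" "\<bar>upper (logistic t)\<bar> \<le> c / 2 * M / n" for t
    using lower_bounds[OF l[of t]] upper_bounds[OF l(1)[of t]] lower_le_upper[OF l(1)[of t]]
    by linarith+
  have cont_l: "continuous_on S logistic" for S
    using logistic_has_derivative by (meson DERIV_isCont continuous_at_imp_continuous_on)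
  have contF: "continuous_on {(t, u). lower (logistic t) \<le> u \<and> u \<le> upper (logistic t)}
      (\<lambda>(t, u). F (logistic t) u)"
    unfolding case_prod_beta
    by (intro continuous_on_compose2[OF continuous_on_F, of _ "\<lambda>y. (logistic (fst y), snd y)", simplified]
        continuous_intros continuous_on_compose2[OF cont_l[of UNIV], of _ fst])
      (auto simp: region)
  show ?thesis
  proof (rule solution_between_barriers[where F = "\<lambda>t. F (logistic t)"
        and \<alpha> = "\<lambda>t. lower (logistic t)" and \<beta> = "\<lambda>t. upper (logistic t)",
        OF C lower_le_upper[OF l(1)] bdd contF])
    show "((\<lambda>t. lower (logistic t)) has_real_derivative
        - ((k - 1) * (k\<^sup>2 - 1) / (1 + (k\<^sup>2 - 1) * logistic t)\<^sup>2) * (logistic t * (1 - logistic t))) (at t)" for t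
      by (rule DERIV_chain2[OF lower_has_derivative[OF l(1)] logistic_has_derivative])
    show "((\<lambda>t. upper (logistic t)) has_real_derivative
        - (c / 2 * M * (M - n) / (n + (M - n) * logistic t)\<^sup>2) * (logistic t * (1 - logistic t))) (at t)" for t
      by (rule DERIV_chain2[OF upper_has_derivative[OF l(1)] logistic_has_derivative])
    show "\<bar>F (logistic t) u + C * u\<bar> \<le> K"
      if "lower (logistic t) \<le> u" "u \<le> upper (logistic t)" for t u
      by (intro K region that)
    show "F (logistic t) u + C * u \<le> F (logistic t) v + C * v"
      if "lower (logistic t) \<le> u" "u \<le> v" "v \<le> upper (logistic t)" for t u v
      using that by (intro mono region) auto
  qed (rule lower_subsolution[OF logistic_bounds] upper_supersolution[OF logistic_bounds] that; assumption)+
qed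

section \<open>Return from the reduced equation to the original system\<close>

lemma profile_exists:
  fixes lam \<phi>\<^sub>0 :: real
  assumes lam: "lam\<^sup>2 = M / p"
    and \<phi>\<^sub>0: "\<phi>\<^sub>0 = sqrt ((p - n / lam\<^sup>2) / (n - p))"
  shows "\<exists>\<phi> \<psi> :: real \<Rightarrow> real.
    smooth \<phi> \<and> smooth \<psi> \<and>
    (\<forall>t. (\<phi> has_real_derivative \<psi> t) (at t)) \<and>
    (\<forall>t. (\<psi> has_real_derivative
        (- \<psi> t
         - ((n - p + p / (1 + lam\<^sup>2 * (\<phi> t)\<^sup>2)) * \<psi> t
            + (n - p + (1 - lam\<^sup>2) * p / (1 + lam\<^sup>2 * (\<phi> t)\<^sup>2)) * \<phi> t)
           * (1 + (\<phi> t + \<psi> t)\<^sup>2))) (at t)) \<and>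
    ((\<lambda>t. (\<phi> t, \<psi> t)) \<longlongrightarrow> (0, 0)) at_bot \<and>
    \<phi> \<in> O[at_bot](\<lambda>t. exp ((k - 1) * t)) \<and>
    \<psi> \<in> O[at_bot](\<lambda>t. exp ((k - 1) * t)) \<and>
    ((\<lambda>t. (\<phi> t, \<psi> t)) \<longlongrightarrow> (\<phi>\<^sub>0, 0)) at_top \<and>
    strict_mono \<phi> \<and>
    (\<forall>t. \<psi> t > 0)"
proof -
  have l: "0 \<le> logistic t" "logistic t \<le> 1" for t
    using logistic_bounds[of t] by auto
  define z_max where "z_max = c / 2 * M / n"
  obtain z where z: "\<And>t. lower (logistic t) \<le> z t" "\<And>t. z t \<le> upper (logistic t)"
    and z': "\<And>t. (z has_real_derivative F (logistic t) (z t)) (at t)"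
    using reduced_solution by blast
  have z_min: "(k - 1) / k\<^sup>2 \<le> z t" and z_max: "z t \<le> z_max" for t
    using z[of t] lower_bounds(1)[OF l] upper_bounds(2)[OF l(1)] unfolding z_max_def
    by (meson order_trans)+
  have k_pos: "0 < (k - 1) / k\<^sup>2"
    using k by simp
  have z_pos: "0 < z t" for t
    using z_min[of t] k_pos by linarith
  have cont_z: "continuous_on UNIV z"
    using z' by (meson DERIV_isCont continuous_at_imp_continuous_on)
  \<comment> \<open>\<open>\<theta>\<close> is the logistic time as a function of the original one:
    \<phi>' = \<psi> means x' = 2 x (1 - x) z, and the logistic function absorbs the factor x (1 -
    x).\<close>
  obtain \<theta> where \<theta>: "\<And>t. (\<theta> has_real_derivative 2 * z (\<theta> t)) (at t)"
    and \<theta>_top: "filterlim \<theta> at_top at_top" and \<theta>_bot: "filterlim \<theta> at_bot at_bot"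
  proof (rule autonomous_ode_solution)
    show "continuous_on UNIV (\<lambda>s. 2 * z s)"
      by (intro continuous_intros cont_z)
    show "0 < 2 * ((k - 1) / k\<^sup>2)"
      using k_pos by (rule mult_pos_pos[OF zero_less_numeral])
    show "2 * ((k - 1) / k\<^sup>2) \<le> 2 * z s" "2 * z s \<le> 2 * z_max" for s
      using z_min[of s] z_max[of s] by linarith+
  qed (rule that; assumption)
  define x where "x t = logistic (\<theta> t)" for t
  define \<zeta> where "\<zeta> t = z (\<theta> t)" for t
  define w where "w t = (1 - x t) * \<zeta> t" for t
  have x: "0 < x t" "x t < 1" for t
    using logistic_bounds by (auto simp: x_def)
  have \<zeta>: "0 < \<zeta> t" "\<zeta> t \<le> z_max" "lower (x t) \<le> \<zeta> t" for t
    using z_pos z_max z by (auto simp: \<zeta>_def x_def)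
  have w_pos: "0 < w t" and w_max: "w t \<le> z_max" for t
  proof -
    show "0 < w t"
      using x[of t] \<zeta>[of t] by (simp add: w_def)
    have "w t \<le> 1 * \<zeta> t"
      using x[of t] \<zeta>[of t] unfolding w_def by (intro mult_right_mono) auto
    then show "w t \<le> z_max"
      using \<zeta>(2)[of t] by simp
  qed
  have x': "(x has_real_derivative 2 * x t * w t) (at t)" for t
    using DERIV_chain2[OF logistic_has_derivative \<theta>, of t]
    by (simp add: x_def[abs_def] w_def \<zeta>_def mult_ac)
  have \<zeta>': "(\<zeta> has_real_derivative F (x t) (\<zeta> t) * (2 * \<zeta> t)) (at t)" for t
    using DERIV_chain2[OF z' \<theta>, of t] by (simp add: x_def \<zeta>_def[abs_def])

  \<comment> \<open>The square of \<open>\<phi>\<^sub>0\<close>, so that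
    \<open>\<phi>\<^sup>2 = Q * x\<close>.\<close>
  define Q where "Q = p * (M - n) / (M * (n - p))"
  have Q: "0 < Q"
    using pos p_pos by (simp add: Q_def)
  have "p - n / lam\<^sup>2 = p * (M - n) / M"
    using pos p_pos by (simp add: lam field_simps)
  then have \<phi>\<^sub>0_eq: "\<phi>\<^sub>0 = sqrt Q"
    by (simp add: \<phi>\<^sub>0 Q_def)
  have lamQ: "lam\<^sup>2 * Q = (M - n) / (n - p)"
    using pos p_pos by (simp add: lam Q_def)
  define \<phi> where "\<phi> t = \<phi>\<^sub>0 * sqrt (x t)" for t
  define \<psi> where "\<psi> t = \<phi> t * w t" for t
  have \<phi>_pos: "0 < \<phi> t" for t
    using x Q by (simp add: \<phi>_def \<phi>\<^sub>0_eq)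
  have \<psi>_pos: "0 < \<psi> t" for t
    using \<phi>_pos w_pos by (simp add: \<psi>_def)
  have \<phi>_sq: "(\<phi> t)\<^sup>2 = Q * x t" for t
    using x[of t] Q by (simp add: \<phi>_def \<phi>\<^sub>0_eq power_mult_distrib)
  have \<phi>': "(\<phi> has_real_derivative \<psi> t) (at t)" for t
  proof -
    have "(\<phi> has_real_derivative \<phi>\<^sub>0 * (2 * x t * w t * (inverse (sqrt (x t)) / 2))) (at t)"
      unfolding \<phi>_def[abs_def] using x[of t]
      by (auto intro!: derivative_eq_intros x')
    moreover have "x t * inverse (sqrt (x t)) = sqrt (x t)"
      using x[of t] by (simp add: real_div_sqrt flip: divide_inverse)
    then have "\<phi>\<^sub>0 * (2 * x t * w t * (inverse (sqrt (x t)) / 2)) = \<psi> t"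
      by (simp add: \<psi>_def \<phi>_def mult_ac)
    ultimately show ?thesis
      by simp
  qed
  define N where "N t = 1 + (M - n) * x t / (n - p)" for t
  have N_eq: "1 + lam\<^sup>2 * (\<phi> t)\<^sup>2 = N t" for t
    by (simp add: \<phi>_sq N_def lamQ flip: mult.assoc)
  have N_pos: "0 < N t" for t
    using x[of t] pos by (simp add: N_def add_pos_pos)
  \<comment> \<open>Up to sign, the square bracket of the system divided by \<phi> and multiplied by
    \<open>N\<close>. In terms of \<open>\<zeta>\<close> it is \<open>w\<close> times the difference
    occurring in \<open>F\<close>.\<close>
  define R where "R t = (M - n) * (1 - x t) - (n + (M - n) * x t) * w t" for t
  have w': "(w has_real_derivative - w t * (1 + w t) + R t * (1 + Q * x t * (1 + w t)\<^sup>2) / N t) (at t)" for t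
  proof -
    have "(w has_real_derivative - (2 * x t * w t) * \<zeta> t + (1 - x t) * (F (x t) (\<zeta> t) * (2 * \<zeta> t))) (at t)"
      unfolding w_def[abs_def] by (auto intro!: derivative_eq_intros x' \<zeta>' simp: w_def)
    moreover have "2 * w t * F (x t) (\<zeta> t)
        = 2 * x t * w t * \<zeta> t - w t * (1 + w t) + R t * (1 + Q * x t * (1 + w t)\<^sup>2) / N t"
    proof -
      have R: "R t = w t * ((M - n) / \<zeta> t - (n + (M - n) * x t))"
        using \<zeta>(1)[of t] by (simp add: R_def w_def field_simps)
      have F: "F (x t) (\<zeta> t) = x t * \<zeta> t - (1 + w t) / 2
          + ((M - n) / \<zeta> t - (n + (M - n) * x t)) * (1 + Q * x t * (1 + w t)\<^sup>2) / (2 * N t)"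
        by (simp add: F_def w_def N_def Q_def)
      have "2 * \<omega> * (a * b - (1 + \<omega>) / 2 + r * q / (2 * m)) = 2 * a * \<omega> * b - \<omega> * (1 + \<omega>) + \<omega> * r * q / m"
        for \<omega> a b r q m :: real
        by (simp add: algebra_simps add_divide_distrib)
      then show ?thesis
        unfolding F R .
    qed
    moreover have "- (2 * x t * w t) * \<zeta> t + (1 - x t) * (F (x t) (\<zeta> t) * (2 * \<zeta> t))
        = - (2 * x t * w t * \<zeta> t) + 2 * w t * F (x t) (\<zeta> t)"
      by (simp add: w_def)
    ultimately show ?thesis
      by simp
  qed
  have coef: "(n - p + p / N t) * w t + (n - p + (1 - lam\<^sup>2) * p / N t) = - R t / N t" for t
  proof -
    have "(n - p) * N t = n - p + (M - n) * x t"
      using pos by (simp add: N_def field_simps)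
    moreover have "(1 - lam\<^sup>2) * p = p - M"
      using p_pos by (simp add: lam field_simps)
    ultimately have R: "((n - p) * N t + p) * w t + ((n - p) * N t + (1 - lam\<^sup>2) * p) = - R t"
      unfolding R_def by (simp only:) (simp add: algebra_simps)
    have "(a + b / N t) * \<omega> + (a + d / N t) = ((a * N t + b) * \<omega> + (a * N t + d)) / N t" for a b d \<omega>
      using N_pos[of t] by (simp add: add_divide_distrib distrib_right)
    then show ?thesis
      unfolding R[symmetric] .
  qed
  have \<psi>': "(\<psi> has_real_derivative
        (- \<psi> t
         - ((n - p + p / (1 + lam\<^sup>2 * (\<phi> t)\<^sup>2)) * \<psi> t
            + (n - p + (1 - lam\<^sup>2) * p / (1 + lam\<^sup>2 * (\<phi> t)\<^sup>2)) * \<phi> t)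
           * (1 + (\<phi> t + \<psi> t)\<^sup>2))) (at t)" for t
  proof -
    have "(\<psi> has_real_derivative
        \<psi> t * w t + \<phi> t * (- w t * (1 + w t) + R t * (1 + Q * x t * (1 + w t)\<^sup>2) / N t)) (at t)"
      unfolding \<psi>_def[abs_def] by (auto intro!: derivative_eq_intros \<phi>' w' simp: \<psi>_def)
    also have "\<psi> t * w t + \<phi> t * (- w t * (1 + w t) + R t * (1 + Q * x t * (1 + w t)\<^sup>2) / N t)
        = - \<psi> t - \<phi> t * (- R t / N t) * (1 + Q * x t * (1 + w t)\<^sup>2)"
      by (simp add: \<psi>_def algebra_simps add_divide_distrib)
    also have "Q * x t * (1 + w t)\<^sup>2 = (\<phi> t + \<psi> t)\<^sup>2"
      by (simp add: \<psi>_def power2_eq_square algebra_simps flip: \<phi>_sq)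
    also have "\<phi> t * (- R t / N t) =
        (n - p + p / N t) * \<psi> t + (n - p + (1 - lam\<^sup>2) * p / N t) * \<phi> t"
      unfolding coef[symmetric] \<psi>_def by (simp only: distrib_left mult_ac)
    finally show ?thesis
      unfolding N_eq .
  qed

  \<comment> \<open>The reciprocal becomes a third generator. Its derivative and that of
    \<open>\<psi>\<close> are then polynomials in the generators; they are written with
    \<open>0 - _\<close> and products instead of unary minus and squares so that the closure rules
    apply literally.\<close>
  define \<gamma> where "\<gamma> t = 1 / N t" for t
  have \<gamma>': "(\<gamma> has_real_derivative 0 - \<gamma> t * \<gamma> t * (2 * lam\<^sup>2) * \<phi> t * \<psi> t) (at t)" for t
  proof -
    have "\<gamma> = (\<lambda>t. 1 / (1 + lam\<^sup>2 * (\<phi> t)\<^sup>2))"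
      by (simp add: \<gamma>_def[abs_def] N_eq)
    moreover have "1 + lam\<^sup>2 * (\<phi> t)\<^sup>2 \<noteq> 0"
      using N_pos[of t] by (simp add: N_eq)
    ultimately show ?thesis
      by (auto intro!: derivative_eq_intros \<phi>' simp: power2_eq_square divide_inverse mult_ac)
  qed
  define S where "S = {\<phi>, \<psi>, \<gamma>}"
  note algebra = generated_algebra.const generated_algebra.add generated_algebra.mult
    generated_algebra_diff
  have gens: "\<phi> \<in> generated_algebra S" "\<psi> \<in> generated_algebra S" "\<gamma> \<in> generated_algebra S"
    by (auto simp: S_def intro: generated_algebra.base)
  have mem_\<psi>: "(\<lambda>t. (0 - \<psi> t) - ((n - p + p * \<gamma> t) * \<psi> t + (n - p + (1 - lam\<^sup>2) * p * \<gamma> t) * \<phi> t)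
        * (1 + (\<phi> t + \<psi> t) * (\<phi> t + \<psi> t))) \<in> generated_algebra S"
    by (intro algebra gens)
  have mem_\<gamma>: "(\<lambda>t. 0 - \<gamma> t * \<gamma> t * (2 * lam\<^sup>2) * \<phi> t * \<psi> t) \<in> generated_algebra S"
    by (intro algebra gens)
  have \<psi>'': "(\<psi> has_real_derivative (0 - \<psi> t) - ((n - p + p * \<gamma> t) * \<psi> t
      + (n - p + (1 - lam\<^sup>2) * p * \<gamma> t) * \<phi> t) * (1 + (\<phi> t + \<psi> t) * (\<phi> t + \<psi> t))) (at t)" for t
    using \<psi>'[of t] by (simp add: N_eq \<gamma>_def flip: power2_eq_square)
  have smooth_S: "\<exists>s'\<in>generated_algebra S. \<forall>t. (s has_real_derivative s' t) (at t)" if s: "s \<in> S" for s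
  proof -
    consider "s = \<phi>" | "s = \<psi>" | "s = \<gamma>"
      using s unfolding S_def by blast
    then show ?thesis
    proof cases
      case 1
      then show ?thesis
        using \<phi>' by (intro bexI[OF _ gens(2)]) simp
    next
      case 2
      then show ?thesis
        using \<psi>'' by (intro bexI[OF _ mem_\<psi>]) simp
    next
      case 3
      then show ?thesis
        using \<gamma>' by (intro bexI[OF _ mem_\<gamma>]) simp
    qed
  qed
  have smooth: "smooth \<phi>" "smooth \<psi>"
    using generated_algebra_smooth[OF smooth_S] gens by blast+

  have x_lim: "(x \<longlongrightarrow> 1) at_top" "(x \<longlongrightarrow> 0) at_bot"
    unfolding x_def[abs_def]
    by (rule filterlim_compose[OF logistic_tendsto(1) \<theta>_top]
        filterlim_compose[OF logistic_tendsto(2) \<theta>_bot])+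
  have \<phi>_lim: "(\<phi> \<longlongrightarrow> \<phi>\<^sub>0) at_top" "(\<phi> \<longlongrightarrow> 0) at_bot"
  proof -
    have "((\<lambda>t. \<phi>\<^sub>0 * sqrt (x t)) \<longlongrightarrow> \<phi>\<^sub>0 * sqrt 1) at_top"
      "((\<lambda>t. \<phi>\<^sub>0 * sqrt (x t)) \<longlongrightarrow> \<phi>\<^sub>0 * sqrt 0) at_bot"
      by (intro tendsto_intros x_lim)+
    then show "(\<phi> \<longlongrightarrow> \<phi>\<^sub>0) at_top" "(\<phi> \<longlongrightarrow> 0) at_bot"
      by (simp_all add: \<phi>_def[abs_def])
  qed
  have \<psi>_le: "\<psi> t \<le> z_max * \<phi> t" for t
    using mult_left_mono[OF w_max, of "\<phi> t"] \<phi>_pos[of t] by (simp add: \<psi>_def mult.commute)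
  \<comment> \<open>The factor 1 - x is kept here, since \<phi> does not vanish at plus infinity;
    the cruder bound above serves at minus infinity.\<close>
  have \<psi>_le': "\<psi> t \<le> \<phi> t * ((1 - x t) * z_max)" for t
    unfolding \<psi>_def w_def using \<phi>_pos[of t] x[of t] \<zeta>[of t] by (intro mult_left_mono) auto
  have \<psi>_bot: "(\<psi> \<longlongrightarrow> 0) at_bot"
  proof (rule tendsto_sandwich[of "\<lambda>_. 0" _ _ "\<lambda>t. z_max * \<phi> t"])
    show "((\<lambda>t. z_max * \<phi> t) \<longlongrightarrow> 0) at_bot"
      by (rule tendsto_mult_right_zero[OF \<phi>_lim(2)])
  qed (use \<psi>_pos \<psi>_le in \<open>auto intro!: always_eventually less_imp_le\<close>)
  have \<psi>_top: "(\<psi> \<longlongrightarrow> 0) at_top"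
  proof (rule tendsto_sandwich[of "\<lambda>_. 0" _ _ "\<lambda>t. \<phi> t * ((1 - x t) * z_max)"])
    have "((\<lambda>t. \<phi> t * ((1 - x t) * z_max)) \<longlongrightarrow> \<phi>\<^sub>0 * ((1 - 1) * z_max)) at_top"
      by (intro tendsto_intros \<phi>_lim x_lim)
    then show "((\<lambda>t. \<phi> t * ((1 - x t) * z_max)) \<longlongrightarrow> 0) at_top"
      by simp
  qed (use \<psi>_pos \<psi>_le' in \<open>auto intro!: always_eventually less_imp_le\<close>)

  \<comment> \<open>\<open>y\<close> is monotone because \<open>\<zeta> \<ge> lower x\<close>, which bounds \<open>\<phi>\<close> by a multiple of \<open>exp ((k - 1) t)\<close>.\<close>
  define y where "y t = ln (x t) / 2 - (k - 1) * t - k\<^sup>2 / 2 * ln (1 - x t)" for t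
  have y_mono: "y s \<le> y t" if "s \<le> t" for s t
  proof (rule DERIV_nonneg_imp_nondecreasing[OF that])
    fix u
    have D: "0 < 1 + (k\<^sup>2 - 1) * x u"
      using x[of u] pos by (intro add_pos_pos mult_pos_pos) auto
    have ln_x: "((\<lambda>t. ln (x t)) has_real_derivative 2 * w u) (at u)"
      using x[of u] by (auto intro!: derivative_eq_intros x')
    have ln_1x: "((\<lambda>t. ln (1 - x t)) has_real_derivative - (2 * x u * \<zeta> u)) (at u)"
      using x[of u] by (auto intro!: derivative_eq_intros x' simp: w_def)
    have "(y has_real_derivative w u - (k - 1) - k\<^sup>2 / 2 * - (2 * x u * \<zeta> u)) (at u)"
      unfolding y_def[abs_def]
      by (rule DERIV_cong[OF DERIV_diff[OF DERIV_diff[OF DERIV_cdivide[OF ln_x] DERIV_cmult_Id]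
              DERIV_cmult[OF ln_1x]]]) simp
    \<comment> \<open>The coefficient \<open>k\<^sup>2 / 2\<close> of the logarithm of 1 - x in
      \<open>y\<close> is chosen so that 1 - x + \<open>k\<^sup>2\<close> x, the denominator of
      \<open>lower\<close>, appears as the factor of \<open>\<zeta>\<close>.\<close>
    moreover have "w u - (k - 1) - k\<^sup>2 / 2 * - (2 * x u * \<zeta> u) = \<zeta> u * (1 + (k\<^sup>2 - 1) * x u) - (k - 1)"
      unfolding w_def by (simp add: algebra_simps)
    moreover have "k - 1 \<le> \<zeta> u * (1 + (k\<^sup>2 - 1) * x u)"
      using \<zeta>(3)[of u] D by (simp add: lower_def pos_divide_le_eq)
    ultimately show "\<exists>y'. (y has_real_derivative y') (at u) \<and> 0 \<le> y'"
      by (metis diff_ge_0_iff_ge)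
  qed
  have \<phi>_exp: "\<phi> t \<le> \<phi>\<^sub>0 * exp (y 0) * exp ((k - 1) * t)" if "t \<le> 0" for t
  proof -
    have "ln (x t) / 2 \<le> y 0 + (k - 1) * t + k\<^sup>2 / 2 * ln (1 - x t)"
      using y_mono[OF that] by (simp add: y_def)
    moreover have "k\<^sup>2 / 2 * ln (1 - x t) \<le> 0"
      using x[of t] by (intro mult_nonneg_nonpos) auto
    ultimately have "ln (x t) / 2 \<le> y 0 + (k - 1) * t"
      by linarith
    then have "exp (ln (x t) / 2) \<le> exp (y 0) * exp ((k - 1) * t)"
      by (simp flip: exp_add)
    moreover have "exp (ln (x t) / 2) = sqrt (x t)"
      using x[of t] by (simp flip: ln_sqrt)
    ultimately show ?thesis
      using Q unfolding \<phi>_def \<phi>\<^sub>0_eq mult.assoc by (intro mult_left_mono) auto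
  qed
  have \<phi>_O: "\<phi> \<in> O[at_bot](\<lambda>t. exp ((k - 1) * t))"
  proof (rule bigoI)
    show "\<forall>\<^sub>F t in at_bot. norm (\<phi> t) \<le> \<phi>\<^sub>0 * exp (y 0) * norm (exp ((k - 1) * t))"
      using eventually_le_at_bot[of 0]
      by eventually_elim (use \<phi>_exp \<phi>_pos in \<open>auto simp: less_imp_le\<close>)
  qed
  have \<psi>_O: "\<psi> \<in> O[at_bot](\<lambda>t. exp ((k - 1) * t))"
  proof (rule landau_o.big_trans[OF bigoI \<phi>_O])
    show "\<forall>\<^sub>F t in at_bot. norm (\<psi> t) \<le> z_max * norm (\<phi> t)"
      using \<psi>_le \<psi>_pos \<phi>_pos by (auto simp: less_imp_le abs_of_pos)
  qed
  have "strict_mono \<phi>"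
    by (intro strict_monoI DERIV_pos_imp_increasing[where f = \<phi>]) (use \<phi>' \<psi>_pos in auto)
  then show ?thesis
    using smooth \<phi>' \<psi>' \<phi>_lim \<psi>_bot \<psi>_top \<phi>_O \<psi>_O \<psi>_pos
    by (intro exI[of _ \<phi>] exI[of _ \<psi>] conjI allI tendsto_Pair)
qed

end

section \<open>The supersolution inequality for admissible triples\<close>

text \<open>With y = x M / S the left-hand side is 3 y = y + 2 y. The first part is at most 1 <= U.
  The second is covered by the p-term of the quotient alone: its factor is (1 + 2 \<delta>) / 3, the
  ratio X / (n - p + X) is at least (1 - \<delta>) y, and (1 + 2 \<delta>) (1 - \<delta>) >= 1
  because \<delta> <= 1/2. What remains is p / 3 >= 2.\<close>

lemma barrier_large_p:
  fixes n p M x :: real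
  assumes p: "6 \<le> p" "p < n" and M: "2 * (n + 1) \<le> M" and x: "0 < x" "x < 1"
  shows "3 * x * M / (n + (M - n) * x) \<le>
      (n + (M - n) * x) / M + 3 / 2 * (1 - x) + (1 - 2 / 3 * (1 - n / M)) *
        ((n - p) * (n + (M - n) * x)\<^sup>2 / M
          + p * (M - n) * x * ((n + (M - n) * x) / M + 3 / 2 * (1 - x))\<^sup>2)
        / (n - p + (M - n) * x)"
proof -
  define \<delta> where "\<delta> = n / M"
  define X where "X = (M - n) * x"
  define S where "S = n + X"
  define U where "U = S / M + 3 / 2 * (1 - x)"
  define y where "y = x * M / S"
  have pos: "0 < n" "n < M" "0 < M" "0 < n - p"
    using p M by auto
  have X: "0 < X" and S: "0 < S"
    unfolding X_def S_def using pos x by (auto intro!: add_pos_pos)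
  have "2 * n \<le> M"
    using M by simp
  then have \<delta>: "0 < \<delta>" "\<delta> \<le> 1 / 2"
    using pos by (auto simp: \<delta>_def field_simps)
  have "S - x * M = n * (1 - x)"
    by (simp add: S_def X_def algebra_simps)
  moreover have "0 \<le> n * (1 - x)"
    using pos x by simp
  ultimately have "x * M \<le> S"
    by linarith
  then have y: "0 < y" "y \<le> 1"
    using S x pos by (auto simp: y_def)
  have U_eq: "U = 1 + (1 / 2 + \<delta>) * (1 - x)"
    using pos by (simp add: U_def S_def X_def \<delta>_def field_simps)
  have "0 \<le> (1 / 2 + \<delta>) * (1 - x)"
    using \<delta> x by simp
  then have U: "1 \<le> U"
    using U_eq by linarith
  then have U2: "1 \<le> U\<^sup>2"
    by simp
  have "(1 - \<delta>) * y = X / S"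
  proof -
    have "(1 - \<delta>) * M = M - n"
      using pos by (simp add: \<delta>_def algebra_simps)
    then show ?thesis
      by (simp add: y_def X_def flip: \<open>_ = M - n\<close>)
  qed
  also have "\<dots> \<le> X / (n - p + X)"
    using X S pos p unfolding S_def by (intro divide_left_mono) auto
  finally have \<theta>: "(1 - \<delta>) * y \<le> X / (n - p + X)" .
  have "0 \<le> \<delta> * (1 - 2 * \<delta>)"
    using \<delta> by simp
  then have "1 \<le> (1 + 2 * \<delta>) * (1 - \<delta>)"
    by (simp add: algebra_simps)
  then have "6 * 1 \<le> p * ((1 + 2 * \<delta>) * (1 - \<delta>))"
    using p by (intro mult_mono) auto
  then have "2 * y \<le> (1 + 2 * \<delta>) / 3 * (p * ((1 - \<delta>) * y))"
    using y mult_right_mono[of 6 "p * ((1 + 2 * \<delta>) * (1 - \<delta>))" y] by (simp add: mult_ac)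
  also have "\<dots> \<le> (1 + 2 * \<delta>) / 3 * (p * (X / (n - p + X) * U\<^sup>2))"
    using \<theta> U2 \<delta> p X pos y mult_mono[OF \<theta> U2]
    by (intro mult_left_mono) auto
  also have "\<dots> \<le> (1 + 2 * \<delta>) / 3 * (((n - p) * S\<^sup>2 / M + p * X * U\<^sup>2) / (n - p + X))"
  proof (intro mult_left_mono)
    have "0 \<le> (n - p) * S\<^sup>2 / M / (n - p + X)"
      using pos X by (intro divide_nonneg_pos mult_nonneg_nonneg) auto
    then show "p * (X / (n - p + X) * U\<^sup>2) \<le> ((n - p) * S\<^sup>2 / M + p * X * U\<^sup>2) / (n - p + X)"
      by (simp only: add_divide_distrib) (simp add: mult.assoc)
  qed (use \<delta> in simp)
  also have "(1 + 2 * \<delta>) / 3 = 1 - 2 / 3 * (1 - n / M)"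
    by (simp add: \<delta>_def field_simps)
  finally have "3 * y \<le> U + (1 - 2 / 3 * (1 - n / M)) * (((n - p) * S\<^sup>2 / M + p * X * U\<^sup>2) / (n - p + X))"
    using y U by linarith
  then show ?thesis
    by (simp add: y_def S_def X_def U_def mult.assoc)
qed

text \<open>Here p / 3 is only 4/3, so U >= 1 is too weak. The sharper U >= 3/2 - x/2 is used both
  alone and squared, and the term with S^2 / M is kept, which contributes at least x. Since 4/3
  times (3/2)^2 is 3, the constant terms cancel and y (2 x - x^2 / 3) <= 3/2 + x/2 remains.\<close>

lemma barrier_7_4:
  fixes M x :: real
  assumes M: "16 \<le> M" and x: "0 < x" "x < 1"
  shows "3 * x * M / (7 + (M - 7) * x) \<le>
      (7 + (M - 7) * x) / M + 3 / 2 * (1 - x) + (1 - 2 / 3 * (1 - 7 / M)) *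
        ((7 - 4) * (7 + (M - 7) * x)\<^sup>2 / M
          + 4 * (M - 7) * x * ((7 + (M - 7) * x) / M + 3 / 2 * (1 - x))\<^sup>2)
        / (7 - 4 + (M - 7) * x)"
proof -
  define \<delta> where "\<delta> = 7 / M"
  define X where "X = (M - 7) * x"
  define S where "S = 7 + X"
  define U where "U = S / M + 3 / 2 * (1 - x)"
  define y where "y = x * M / S"
  have X: "0 < X" and S: "0 < S"
    unfolding X_def S_def using M x by (auto intro!: add_pos_pos)
  have \<delta>: "0 < \<delta>" "\<delta> \<le> 1 / 2"
    using M by (auto simp: \<delta>_def field_simps)
  have Sx: "S - x * M = 7 * (1 - x)"
    by (simp add: S_def X_def algebra_simps)
  then have y: "0 < y" "y \<le> 1"
    using S x M by (auto simp: y_def)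
  have xS: "x \<le> S / M"
    using Sx x M by (simp add: field_simps)
  have U_eq: "U = 3 / 2 - x / 2 + \<delta> * (1 - x)"
    using M by (simp add: U_def S_def X_def \<delta>_def field_simps)
  have U: "3 / 2 - x / 2 \<le> U"
    unfolding U_eq using \<delta> x by simp
  then have U2: "(3 / 2 - x / 2)\<^sup>2 \<le> U\<^sup>2"
    using x by (intro power_mono) auto
  have "(1 - \<delta>) * y = X / S"
  proof -
    have "(1 - \<delta>) * M = M - 7"
      using M by (simp add: \<delta>_def algebra_simps)
    then show ?thesis
      by (simp add: y_def X_def flip: \<open>_ = M - 7\<close>)
  qed
  also have "\<dots> \<le> X / (3 + X)"
    using X S unfolding S_def by (intro divide_left_mono) auto
  finally have \<theta>: "(1 - \<delta>) * y \<le> X / (3 + X)" .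
  have "0 \<le> \<delta> * (1 - 2 * \<delta>)"
    using \<delta> by simp
  then have \<delta>1: "1 \<le> (1 + 2 * \<delta>) * (1 - \<delta>)"
    by (simp add: algebra_simps)
  have "4 / 3 * (y * (3 / 2 - x / 2)\<^sup>2) \<le> (1 + 2 * \<delta>) / 3 * (4 * ((1 - \<delta>) * y * (3 / 2 - x / 2)\<^sup>2))"
    using mult_right_mono[OF \<delta>1, of "4 / 3 * (y * (3 / 2 - x / 2)\<^sup>2)"] y by (simp add: mult_ac)
  also have "\<dots> \<le> (1 + 2 * \<delta>) / 3 * (4 * (X / (3 + X) * U\<^sup>2))"
    using \<delta> X by (intro mult_left_mono mult_mono \<theta> U2) auto
  finally have a: "4 / 3 * (y * (3 / 2 - x / 2)\<^sup>2) \<le> (1 + 2 * \<delta>) / 3 * (4 * X * U\<^sup>2 / (3 + X))"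
    by simp
  have "x \<le> 1 * (3 * (S / M) * (S / (3 + X))) / 3"
  proof -
    have "1 \<le> S / (3 + X)"
      using X by (simp add: S_def)
    then have "x * 1 \<le> S / M * (S / (3 + X))"
      using xS x by (intro mult_mono) auto
    then show ?thesis
      by simp
  qed
  also have "\<dots> \<le> (1 + 2 * \<delta>) * (3 * (S / M) * (S / (3 + X))) / 3"
    using \<delta> S M X by (intro divide_right_mono mult_right_mono) auto
  finally have b: "x \<le> (1 + 2 * \<delta>) / 3 * (3 * S\<^sup>2 / M / (3 + X))"
    by (simp add: power2_eq_square)
  have "3 * y - 4 / 3 * (y * (3 / 2 - x / 2)\<^sup>2) \<le> 3 / 2 + x / 2"
  proof -
    have "y * (2 * x - x\<^sup>2 / 3) \<le> 1 * (2 * x - x\<^sup>2 / 3)"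
    proof (intro mult_right_mono)
      have "x * x \<le> 1 * x"
        using x by (intro mult_right_mono) auto
      then show "0 \<le> 2 * x - x\<^sup>2 / 3"
        using x by (simp add: power2_eq_square)
    qed (use y in auto)
    also have "\<dots> \<le> 3 / 2 + x / 2"
      unfolding mult_1 using x zero_le_power2[of x] by linarith
    finally show ?thesis
      by (simp add: power2_eq_square algebra_simps)
  qed
  with a b U have "3 * y \<le> U + ((1 + 2 * \<delta>) / 3 * (3 * S\<^sup>2 / M / (3 + X))
      + (1 + 2 * \<delta>) / 3 * (4 * X * U\<^sup>2 / (3 + X)))"
    by linarith
  also have "\<dots> = U + (1 - 2 / 3 * (1 - 7 / M)) * (3 * S\<^sup>2 / M + 4 * X * U\<^sup>2) / (3 + X)"
  proof -
    have "(1 + 2 * \<delta>) / 3 = 1 - 2 / 3 * (1 - 7 / M)"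
      by (simp add: \<delta>_def field_simps)
    then show ?thesis
      by (simp only: add_divide_distrib distrib_left times_divide_eq_right)
  qed
  finally show ?thesis
    by (simp add: y_def S_def X_def U_def mult.assoc del: right_diff_distrib_numeral)
qed

text \<open>Linear relations between the powers that reduce the positivity of the quartics below to
  linear arithmetic. The last one is (x - x^2)^2 >= 0; through it a positive quartic coefficient can
  absorb part of a negative cubic one.\<close>

lemma powers_unit_interval:
  fixes x :: real
  assumes "0 < x" "x < 1"
  shows "0 \<le> x ^ 4" "x ^ 4 \<le> x\<^sup>2" "x\<^sup>2 \<le> x" "x ^ 3 \<le> x" "2 * x ^ 3 \<le> x\<^sup>2 + x ^ 4"
proof -
  show "2 * x ^ 3 \<le> x\<^sup>2 + x ^ 4"
    using zero_le_power2[of "x - x\<^sup>2"]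
    by (simp add: algebra_simps power2_eq_square power3_eq_cube power4_eq_xxxx)
qed (use assms power_decreasing[of 2 4 x] power_decreasing[of 1 2 x] power_decreasing[of 1 3 x] in auto)

lemma barrier_3_2_2:
  fixes x :: real
  assumes x: "0 < x" "x < 1"
  shows "2 * x * 8 / (3 + (8 - 3) * x) \<le>
      (3 + (8 - 3) * x) / 8 + 2 / 2 * (1 - x) + (1 - 2 / 2 * (1 - 3 / 8)) *
        ((3 - 2) * (3 + (8 - 3) * x)\<^sup>2 / 8
          + 2 * (8 - 3) * x * ((3 + (8 - 3) * x) / 8 + 2 / 2 * (1 - x))\<^sup>2)
        / (3 - 2 + (8 - 3) * x)" (is "?L \<le> ?R")
proof -
  have D: "0 < 3 + 5 * x" "0 < 1 + 5 * x"
    using x by auto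
  \<comment> \<open>The quartic is the numerator of \<open>?R - ?L\<close> over the common
    denominator (3 + 5 x) (1 + 5 x). The two lemmas that follow are built in the same way.\<close>
  have "0 \<le> 345 / 64 + 9721 / 256 * x - 4795 / 256 * x\<^sup>2 - 5445 / 256 * x ^ 3 + 675 / 256 * x ^ 4"
    using powers_unit_interval[OF x] x by linarith
  then have "0 \<le> (345 / 64 + 9721 / 256 * x - 4795 / 256 * x\<^sup>2 - 5445 / 256 * x ^ 3 + 675 / 256 * x ^ 4) / ((3 + 5 * x) * (1 + 5 * x))"
    using mult_pos_pos[OF D] by (rule divide_nonneg_pos)
  also have "\<dots> = ?R - ?L"
    using D by (simp add: divide_simps power2_eq_square) algebra
  finally show ?thesis
    by simp
qed

lemma barrier_5_4_2:
  fixes x :: real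
  assumes x: "0 < x" "x < 1"
  shows "3 * x * 12 / (5 + (12 - 5) * x) \<le>
      (5 + (12 - 5) * x) / 12 + 3 / 2 * (1 - x) + (1 - 2 / 3 * (1 - 5 / 12)) *
        ((5 - 4) * (5 + (12 - 5) * x)\<^sup>2 / 12
          + 4 * (12 - 5) * x * ((5 + (12 - 5) * x) / 12 + 3 / 2 * (1 - x))\<^sup>2)
        / (5 - 4 + (12 - 5) * x)" (is "?L \<le> ?R")
proof -
  have D: "0 < 5 + 7 * x" "0 < 1 + 7 * x"
    using x by auto
  have "0 \<le> 3445 / 216 + 30857 / 81 * x - 2135 / 108 * x\<^sup>2 - 3388 / 9 * x ^ 3 + 65219 / 648 * x ^ 4"
    using powers_unit_interval[OF x] x by linarith
  then have "0 \<le> (3445 / 216 + 30857 / 81 * x - 2135 / 108 * x\<^sup>2 - 3388 / 9 * x ^ 3 + 65219 / 648 * x ^ 4) / ((5 + 7 * x) * (1 + 7 * x))"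
    using mult_pos_pos[OF D] by (rule divide_nonneg_pos)
  also have "\<dots> = ?R - ?L"
    using D by (simp add: divide_simps power2_eq_square) algebra
  finally show ?thesis
    by simp
qed

lemma barrier_5_4_4:
  fixes x :: real
  assumes x: "0 < x" "x < 1"
  shows "3 * x * 32 / (5 + (32 - 5) * x) \<le>
      (5 + (32 - 5) * x) / 32 + 3 / 2 * (1 - x) + (1 - 2 / 3 * (1 - 5 / 32)) *
        ((5 - 4) * (5 + (32 - 5) * x)\<^sup>2 / 32
          + 4 * (32 - 5) * x * ((5 + (32 - 5) * x) / 32 + 3 / 2 * (1 - x))\<^sup>2)
        / (5 - 4 + (32 - 5) * x)" (is "?L \<le> ?R")
proof -
  have D: "0 < 5 + 27 * x" "0 < 1 + 27 * x"
    using x by auto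
  have "0 \<le> 5115 / 512 + 3460257 / 4096 * x + 6736365 / 4096 * x\<^sup>2 - 11799837 / 4096 * x ^ 3 + 2250423 / 4096 * x ^ 4"
    using powers_unit_interval[OF x] x by linarith
  then have "0 \<le> (5115 / 512 + 3460257 / 4096 * x + 6736365 / 4096 * x\<^sup>2 - 11799837 / 4096 * x ^ 3 + 2250423 / 4096 * x ^ 4) / ((5 + 27 * x) * (1 + 27 * x))"
    using mult_pos_pos[OF D] by (rule divide_nonneg_pos)
  also have "\<dots> = ?R - ?L"
    using D by (simp add: divide_simps power2_eq_square) algebra
  finally show ?thesis
    by simp
qed

theorem proposition3p3:
  fixes n p k :: nat and lam \<phi>\<^sub>0 :: real
  assumes "admissible n p k"
    and "(n, p, k) = (3, 2, 2) \<or> (n, p, k) = (5, 4, 2) \<or> (n, p, k) = (5, 4, 4) \<or> n \<ge> 7"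
    and "lam\<^sup>2 = real k * (real k + real n - 1) / real p"
    and "\<phi>\<^sub>0 = sqrt ((real p - real n / lam\<^sup>2) / (real n - real p))"
  shows "\<exists>\<phi> \<psi> :: real \<Rightarrow> real.
    smooth \<phi> \<and> smooth \<psi> \<and>
    (\<forall>t. (\<phi> has_real_derivative \<psi> t) (at t)) \<and>
    (\<forall>t. (\<psi> has_real_derivative
        (- \<psi> t
         - ((real n - real p + real p / (1 + lam\<^sup>2 * (\<phi> t)\<^sup>2)) * \<psi> t
            + (real n - real p + (1 - lam\<^sup>2) * real p / (1 + lam\<^sup>2 * (\<phi> t)\<^sup>2)) * \<phi> t)
           * (1 + (\<phi> t + \<psi> t)\<^sup>2))) (at t)) \<and>
    ((\<lambda>t. (\<phi> t, \<psi> t)) \<longlongrightarrow> (0, 0)) at_bot \<and>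
    \<phi> \<in> O[at_bot](\<lambda>t. exp ((real k - 1) * t)) \<and>
    \<psi> \<in> O[at_bot](\<lambda>t. exp ((real k - 1) * t)) \<and>
    ((\<lambda>t. (\<phi> t, \<psi> t)) \<longlongrightarrow> (\<phi>\<^sub>0, 0)) at_top \<and>
    strict_mono \<phi> \<and>
    (\<forall>t. \<psi> t > 0)"
proof -
  have k: "2 \<le> k"
    using assms(1) by (auto simp: admissible_def elim: evenE)
  define M where "M = real k * (real k + real n - 1)"
  \<comment> \<open>Among the families with n >= 7, the pair (4 l + 3, 4 l) with l = 1 is the only
    one with p < 6.\<close>
  have "0 < p" and pn: "p < n" and cases: "n \<ge> 7 \<Longrightarrow> p \<ge> 6 \<or> (n, p) = (7, 4)"
    using assms(1) by (auto simp: admissible_def)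
  have lam: "lam\<^sup>2 = M / real p"
    using assms(3) by (simp add: M_def)
  have profile: "profile_equation (real n) (real p) (real k) M c"
    if "2 \<le> c" and "\<And>x. 0 < x \<Longrightarrow> x < 1 \<Longrightarrow>
      c * x * M / (n + (M - n) * x) \<le>
      (n + (M - n) * x) / M + c / 2 * (1 - x) + (1 - 2 / c * (1 - n / M)) *
        ((real n - real p) * (n + (M - n) * x)\<^sup>2 / M
          + p * (M - n) * x * ((n + (M - n) * x) / M + c / 2 * (1 - x))\<^sup>2)
        / (real n - real p + (M - n) * x)" for c
    using that k \<open>0 < p\<close> pn by unfold_locales (auto simp: M_def)
  \<comment> \<open>k >= 2 is used twice: for the first factor of \<open>M\<close> and for k + n - 1
    >= n + 1. The result gives n / M <= 1/2 in the large-p estimate and M >= 16 for n = 7.\<close>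
  have "2 * (real k + real n - 1) \<le> M"
    unfolding M_def using k by (intro mult_right_mono) auto
  then have M: "2 * (real n + 1) \<le> M"
    using k by simp
  consider "(n, p, k) = (3, 2, 2)" | "(n, p, k) = (5, 4, 2)" | "(n, p, k) = (5, 4, 4)"
    | "(n, p) = (7, 4)" | "p \<ge> 6"
    using assms(2) cases by blast
  then have "\<exists>c. profile_equation (real n) (real p) (real k) M c"
  proof cases
    case 1
    then have "M = 8"
      by (simp add: M_def)
    with 1 show ?thesis
      using barrier_3_2_2 by (intro exI[of _ 2] profile) auto
  next
    case 2
    then have "M = 12"
      by (simp add: M_def)
    with 2 show ?thesis
      using barrier_5_4_2 by (intro exI[of _ 3] profile) auto
  next
    case 3
    then have "M = 32"
      by (simp add: M_def)
    with 3 show ?thesis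
      using barrier_5_4_4 by (intro exI[of _ 3] profile) auto
  next
    case 4
    with M have "16 \<le> M"
      by simp
    from barrier_7_4[OF this] 4 show ?thesis
      by (intro exI[of _ 3] profile) auto
  next
    case 5
    show ?thesis
      using 5 pn M by (intro exI[of _ 3] profile barrier_large_p) auto
  qed
  then obtain c where "profile_equation (real n) (real p) (real k) M c"
    by blast
  then show ?thesis
    using profile_equation.profile_exists[OF _ lam assms(4)] by blast
qed

end
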